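(* Let $\chi(\hbar)=\sum_{n\ge0}(2n-1)!!\,\hbar^n$, and let $Z,W,G$ be the partition function, free energy and effective action of zero-dimensional quenched QED. Then $$Z(\hbar,j,\eta)=e^{\frac{j^2}{2\hbar}}\left(1+\frac{|\eta|^2}{\hbar(1-j)}\chi\!\left(\frac{\hbar}{(1-j)^2}\right)+\mathcal{O}(|\eta|^4)\right),\quad W(\hbar,j,\eta)=\frac{j^2}{2}+\frac{|\eta|^2}{1-j}\chi\!\left(\frac{\hbar}{(1-j)^2}\right)+\mathcal{O}(|\eta|^4),$$ $$G(\hbar,\varphi_c,\psi_c)=-\frac{\varphi_c^2}{2}+|\psi_c|^2\frac{\varphi_c-1}{\chi\left(\frac{\hbar}{(1-\varphi_c)^2}\right)}+\mathcal{O}(|\psi_c|^4),$$ and, coefficientwise in $j$ (resp. $\varphi_c$) and up to the indicated order in $|\eta|^2$ (resp. $|\psi_c|^2$), their factorial asymptotic expansions with $A=\frac12$ are $$\mathcal{A}^{\frac12}_\hbar Z=\frac{|\eta|^2e^{\frac j\hbar}}{\sqrt{2\pi}\,\hbar^{3/2}}+\mathcal{O}(|\eta|^4),\qquad \mathcal{A}^{\frac12}_\hbar W=\frac{|\eta|^2e^{\frac{1}{\hbar}\left(j-\frac{j^2}{2}\right)}}{\sqrt{2\pi\hbar}}+\mathcal{O}(|\eta|^4),$$ $$\mathcal{A}^{\frac12}_\hbar G=|\psi_c|^2\,\frac{e^{\frac1\hbar\left(\varphi_c-\frac{\varphi_c^2}{2}\right)}}{\sqrt{2\pi\hbar}}\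,\frac{(1-\varphi_c)^2}{\chi\left(\frac{\hbar}{(1-\varphi_c)^2}\right)^2}+\mathcal{O}(|\psi_c|^4).$$
   Context: The partition function is the formal perturbative expansion of $Z(\hbar,j,\eta)=\int\frac{dx}{\sqrt{2\pi\hbar}}e^{\frac1\hbar\left(-\frac{x^2}{2}+jx+\frac{|\eta|^2}{1-x}\right)}$, with $|\eta|^2=\eta\bar\eta$: expand the exponentials of $jx/\hbar$ and of $|\eta|^2/(\hbar(1-x))$, and $\frac1{1-x}$, in powers of $j,|\eta|^2,x$ and integrate termwise by $\int\frac{dx}{\sqrt{2\pi\hbar}}e^{-x^2/(2\hbar)}x^{2n}=\hbar^n(2n-1)!!$ (odd moments vanish; $(-1)!!=1$). $W=\hbar\log Z$, and $G(\hbar,\varphi_c,\psi_c)=W-j\varphi_c-\bar\eta\psi_c-\eta\bar\psi_c$ with $\varphi_c=\partial_jW$, $\psi_c=\partial_{\bar\eta}W$ (Legendre transform). Asymptotic operator: a power (or Laurent, with finitely many negative powers) series $f(\hbar)=\sum_nf_n\hbar^n$ has a factorial asymptotic expansion with parameter $A>0$ if there are $\beta\in\mathbb{R}$, $c_k\in\mathbb{R}$ with $f_n=\sum_{k=0}^{R-1}c_kA^{-n-\beta+k}\Gamma(n+\beta-k)+\mathcal{O}(A^{-n}\Gamma(n+\beta-R))$ as $n\to\infty$ for all $R\ge0$; then $(\mathcal{A}^A_\hbar f)(\hbar):=\hbar^{-\beta}\sum_kc_k\hbar^k$. It acts on each coefficient of a series in the other variables. *)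

theory Defs
  imports
    "HOL-Analysis.Analysis"
    "HOL-Library.Landau_Symbols"
    "HOL-Computational_Algebra.Computational_Algebra"
begin

unbundle no vec_syntax
unbundle fps_syntax

section \<open>Formal series rings\<close>

text \<open>
  Series in \<open>j\<close> and \<open>s = |\<eta>|\<^sup>2\<close> with coefficients in the field of formal Laurent series in \<open>\<hbar>\<close>.
  The outer variable is \<open>s\<close>, the inner one is \<open>j\<close>: the coefficient of \<open>s\<^sup>m j\<^sup>a\<close> in \<open>F\<close> is
  \<open>F $ m $ a\<close>.  The same type is used for series in \<open>\<phi>\<^sub>c\<close> and \<open>|\<psi>\<^sub>c|\<^sup>2\<close>.
\<close>
type_synonym bser = "real fls fps fps"

text \<open>
  Series in \<open>j\<close>, \<open>\<eta>\<close>, \<open>\<eta>bar\<close>: the coefficient of \<open>\<eta>bar\<^sup>q \<eta>\<^sup>p j\<^sup>l\<close> in \<open>F\<close> is \<open>F $ q $ p $ l\<close>.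
\<close>
type_synonym tser = "real fls fps fps fps"

abbreviation hbar :: "real fls"
  where "hbar \<equiv> fls_X"


section \<open>Partition function and free energy\<close>

text \<open>\<open>odd_dfact n = (2n-1)!!\<close>, with \<open>(-1)!! = 1\<close>.\<close>
definition odd_dfact :: "nat \<Rightarrow> real"
  where "odd_dfact n = (\<Prod>k<n. 2 * real k + 1)"

text \<open>
  Termwise integration of a power series in \<open>x\<close> against \<open>exp (- x\<^sup>2 / (2 \<hbar>)) dx / sqrt (2 \<pi> \<hbar>)\<close>.
\<close>
definition gauss_integral :: "real fps \<Rightarrow> real fls"
  where "gauss_integral p = fps_to_fls (Abs_fps (\<lambda>n. p $ (2 * n) * odd_dfact n))"

text \<open>
  The coefficient of \<open>|\<eta>|\<^sup>2\<^sup>m j\<^sup>a\<close> in \<open>exp (j x / \<hbar> + |\<eta>|\<^sup>2 / (\<hbar> (1 - x)))\<close> is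
  \<open>x\<^sup>a (1 - x)\<^sup>-\<^sup>m / (\<hbar>\<^sup>a\<^sup>+\<^sup>m a! m!)\<close>.
\<close>
definition qqed_Z :: bser
  where "qqed_Z = Abs_fps (\<lambda>m. Abs_fps (\<lambda>a.
           fls_const (1 / (fact a * fact m)) * (1 / hbar) ^ (a + m)
             * gauss_integral (fps_X ^ a * inverse (1 - fps_X) ^ m)))"

text \<open>
  The logarithm \<open>\<Sum>n\<ge>1. (-1)\<^sup>n\<^sup>+\<^sup>1 (F - 1)\<^sup>n / n\<close> of a series \<open>F\<close> with constant term \<open>1\<close>.
  As \<open>(F - 1)\<^sup>n\<close> has no terms of total degree below \<open>n\<close>, the sum can be cut off for each coefficient.
\<close>
definition bser_log :: "bser \<Rightarrow> bser"
  where "bser_log F = Abs_fps (\<lambda>m. Abs_fps (\<lambda>a.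
           \<Sum>n = 1..m + a. (- 1) ^ (n + 1) / of_nat n * ((F - 1) ^ n $ m $ a)))"

definition qqed_W :: bser
  where "qqed_W = fps_const (fps_const hbar) * bser_log qqed_Z"


section \<open>Effective action\<close>

text \<open>The series \<open>F(j, \<eta> \<eta>bar)\<close>.\<close>
definition tser_of :: "bser \<Rightarrow> tser"
  where "tser_of F = Abs_fps (\<lambda>q. Abs_fps (\<lambda>p. if p = q then F $ q else 0))"

definition var_j :: tser where "var_j = fps_const (fps_const fps_X)"
definition var_eta :: tser where "var_eta = fps_const fps_X"
definition var_etabar :: tser where "var_etabar = fps_X"

definition deriv_j :: "tser \<Rightarrow> tser"
  where "deriv_j F = Abs_fps (\<lambda>q. Abs_fps (\<lambda>p. fps_deriv (F $ q $ p)))"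

definition deriv_eta :: "tser \<Rightarrow> tser"
  where "deriv_eta F = Abs_fps (\<lambda>q. fps_deriv (F $ q))"

definition deriv_etabar :: "tser \<Rightarrow> tser"
  where "deriv_etabar F = fps_deriv F"

text \<open>
  The substitution \<open>G(\<Phi>, U) = \<Sum>m a. G $ m $ a * \<Phi>\<^sup>a * U\<^sup>m\<close>.
  It is meaningful for \<open>\<Phi>\<close> and \<open>U\<close> without constant term; then \<open>\<Phi>\<^sup>a U\<^sup>m\<close> has no terms of total
  degree below \<open>a + m\<close>, so that the cut-off does not omit any contribution.
\<close>
definition tser_subst :: "bser \<Rightarrow> tser \<Rightarrow> tser \<Rightarrow> tser"
  where "tser_subst G \<Phi> U = Abs_fps (\<lambda>q. Abs_fps (\<lambda>p. Abs_fps (\<lambda>l.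
           \<Sum>m\<le>q + p + l. \<Sum>a\<le>q + p + l. G $ m $ a * ((\<Phi> ^ a * U ^ m) $ q $ p $ l))))"

text \<open>
  \<open>G(\<phi>\<^sub>c, |\<psi>\<^sub>c|\<^sup>2) = W - j \<phi>\<^sub>c - \<eta>bar \<psi>\<^sub>c - \<eta> \<psi>bar\<^sub>c\<close> where \<open>\<phi>\<^sub>c = \<partial>W/\<partial>j\<close>, \<open>\<psi>\<^sub>c = \<partial>W/\<partial>\<eta>bar\<close>,
  and \<open>\<psi>bar\<^sub>c = \<partial>W/\<partial>\<eta>\<close> is the conjugate of \<open>\<psi>\<^sub>c\<close>, as \<open>W\<close> is real.
\<close>
definition is_legendre_transform :: "bser \<Rightarrow> bser \<Rightarrow> bool"
  where "is_legendre_transform W G \<longleftrightarrow>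
    (let w = tser_of W; \<phi> = deriv_j w; \<psi> = deriv_etabar w; \<psi>bar = deriv_eta w
     in tser_subst G \<phi> (\<psi> * \<psi>bar)
          = w - var_j * \<phi> - var_etabar * \<psi> - var_eta * \<psi>bar)"

text \<open>
  The map from \<open>(j, |\<eta>|\<^sup>2)\<close> to \<open>(\<phi>\<^sub>c, |\<psi>\<^sub>c|\<^sup>2)\<close> is formally invertible, as \<open>\<phi>\<^sub>c = j + O(|\<eta>|\<^sup>2)\<close> and
  \<open>|\<psi>\<^sub>c|\<^sup>2\<close> is \<open>|\<eta>|\<^sup>2\<close> times a unit; hence there is exactly one such series.
\<close>
definition qqed_G :: bser
  where "qqed_G = (THE G. is_legendre_transform qqed_W G)"


section \<open>The series \<open>\<chi>\<close>\<close>

definition chi :: "real fps"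
  where "chi = Abs_fps odd_dfact"

text \<open>\<open>f(\<hbar> g(j))\<close>, as a power series in \<open>j\<close>.\<close>
definition hbar_rescale :: "real fps \<Rightarrow> real fps \<Rightarrow> real fls fps"
  where "hbar_rescale f g = Abs_fps (\<lambda>l. fps_to_fls (Abs_fps (\<lambda>n. f $ n * (g ^ n $ l))))"

text \<open>\<open>\<chi>(\<hbar> / (1 - j)\<^sup>2)\<close>\<close>
definition chi_resc :: "real fls fps"
  where "chi_resc = hbar_rescale chi (inverse ((1 - fps_X) ^ 2))"


section \<open>Factorial asymptotic expansions\<close>

text \<open>
  \<open>\<hbar>\<^sup>\<alpha> L(\<hbar>)\<close> for real \<open>\<alpha>\<close>, as the function that maps a real exponent to the coefficient of that
  power of \<open>\<hbar>\<close>.  Different pairs \<open>(\<alpha>, L)\<close> can represent the same generalised series.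
\<close>
definition hbar_powr_times :: "real \<Rightarrow> real fls \<Rightarrow> (real \<Rightarrow> real)"
  where "hbar_powr_times \<alpha> L = (\<lambda>e. if e - \<alpha> \<in> \<int> then L $$ \<lfloor>e - \<alpha>\<rfloor> else 0)"

text \<open>
  \<open>f\<close> has a factorial asymptotic expansion with parameter \<open>A\<close>, and the asymptotic operator maps \<open>f\<close>
  to \<open>g = \<hbar>\<^sup>-\<^sup>\<beta> \<Sum>k. c\<^sub>k \<hbar>\<^sup>k\<close>.  Only \<open>g\<close> is determined by \<open>f\<close>; the exponent \<open>\<beta>\<close> is not (it may be
  increased by \<open>1\<close> and the \<open>c\<^sub>k\<close> shifted, and it is arbitrary if all \<open>c\<^sub>k\<close> vanish).
\<close>
definition has_factorial_asymptotics :: "real \<Rightarrow> real fls \<Rightarrow> (real \<Rightarrow> real) \<Rightarrow> bool"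
  where "has_factorial_asymptotics A f g \<longleftrightarrow> A > 0 \<and>
    (\<exists>(\<beta>::real) (c::nat \<Rightarrow> real).
       (\<forall>R. (\<lambda>n::nat. f $$ int n
               - (\<Sum>k<R. c k * A powr (- real n - \<beta> + real k) * Gamma (real n + \<beta> - real k)))
             \<in> O(\<lambda>n::nat. A powr (- real n) * Gamma (real n + \<beta> - real R)))
       \<and> g = hbar_powr_times (- \<beta>) (fps_to_fls (Abs_fps c)))"

text \<open>
  The asymptotic operator, applied to each coefficient of \<open>F\<close>, gives \<open>\<hbar>\<^sup>\<alpha> T\<close> up to terms of order
  \<open>M\<close> in the outer variable.
\<close>
definition has_asymptotics_upto :: "nat \<Rightarrow> real \<Rightarrow> bser \<Rightarrow> real \<Rightarrow> bser \<Rightarrow> bool"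
  where "has_asymptotics_upto M A F \<alpha> T \<longleftrightarrow>
    (\<forall>m<M. \<forall>a. has_factorial_asymptotics A (F $ m $ a) (hbar_powr_times \<alpha> (T $ m $ a)))"

text \<open>\<open>exp (p(j) / \<hbar>)\<close> for \<open>p\<close> without constant term\<close>
definition exp_over_hbar :: "real fls fps \<Rightarrow> real fls fps"
  where "exp_over_hbar p = fps_compose (fps_exp (1 / hbar)) p"

text \<open>A real constant\<close>
definition rconst :: "real \<Rightarrow> real fls fps"
  where "rconst r = fps_const (fls_const r)"

end

theory Submission
  imports Defs
begin

text \<open>
  At first order in \<open>s = |\<eta>|\<^sup>2\<close> everything is governed by
  \<open>V(j) = \<chi>(\<hbar>/(1-j)\<^sup>2)/(1-j)\<close>, which solves \<open>(1 - j) V - \<hbar> V' = 1\<close>.  The identity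
  \<open>x\<^sup>a/(1-x) - x\<^sup>a\<^sup>+\<^sup>1/(1-x) = x\<^sup>a\<close> under the Gaussian integral is a first order equation in \<open>j\<close> for
  \<open>Z\<^sub>1\<close>, with solution \<open>exp(j\<^sup>2/2\<hbar>) V/\<hbar>\<close>; hence \<open>W\<^sub>1 = V\<close>.  The Legendre equation is triangular in powers of
  \<open>s\<close> with invertible diagonal entries \<open>V\<^sup>2\<^sup>m\<close>, so it has a unique solution, and \<open>G\<^sub>1 = -1/V\<close>.

  The asymptotic operator is a derivation on factorially divergent series, that is, the pairs
  \<open>f + \<epsilon> \<A> f\<close> form a ring of dual numbers which is closed under inversion.  As \<open>\<A>\<chi>\<close> is a constant multiple of
  \<open>\<hbar>\<^sup>-\<^sup>1\<^sup>/\<^sup>2\<close>, the differential equation for \<open>V\<close> yields \<open>(1 - j) \<A>V = \<hbar> (\<A>V)'\<close> and thus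
  \<open>\<A>V\<close>, and \<open>\<A>(-1/V) = \<A>V/V\<^sup>2\<close>.
\<close>

section \<open>Factorially divergent power series\<close>

lemma odd_dfact_0 [simp]: "odd_dfact 0 = 1"
  by (simp add: odd_dfact_def)

lemma odd_dfact_Suc: "odd_dfact (Suc n) = (2 * real n + 1) * odd_dfact n"
  by (simp add: odd_dfact_def mult.commute)

lemma odd_dfact_pos [simp]: "odd_dfact n > 0"
  by (induction n) (simp_all add: odd_dfact_Suc)

lemma odd_dfact_nonneg [simp]: "odd_dfact n \<ge> 0"
  using odd_dfact_pos[of n] by linarith

lemma odd_dfact_nonzero [simp]: "odd_dfact n \<noteq> 0"
  using odd_dfact_pos[of n] by linarith

lemma odd_dfact_mono: "m \<le> n \<Longrightarrow> odd_dfact m \<le> odd_dfact n"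
proof (induction rule: dec_induct)
  case (step k)
  have "odd_dfact k * 1 \<le> odd_dfact k * (2 * real k + 1)"
    by (intro mult_left_mono) auto
  then have "odd_dfact k \<le> odd_dfact (Suc k)" by (simp add: odd_dfact_Suc algebra_simps)
  with step show ?case by linarith
qed auto

text \<open>Log-convexity: each of the \<open>t\<close> factors \<open>2i + 1\<close> gained from
  \<open>a\<close> to \<open>a + t\<close> is at most the corresponding factor gained from
  \<open>j\<close>. So products with a fixed sum of arguments grow towards the ends.\<close>

lemma odd_dfact_mult_le:
  assumes "a \<le> j"
  shows "odd_dfact (a + t) * odd_dfact j \<le> odd_dfact a * odd_dfact (j + t)"
proof (induction t)
  case (Suc t)
  have "odd_dfact (a + Suc t) * odd_dfact j = (2 * real (a + t) + 1) * (odd_dfact (a + t) * odd_dfact j)"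
    by (simp add: odd_dfact_Suc)
  also have "\<dots> \<le> (2 * real (j + t) + 1) * (odd_dfact a * odd_dfact (j + t))"
    using assms by (intro mult_mono Suc.IH) auto
  also have "\<dots> = odd_dfact a * odd_dfact (j + Suc t)"
    by (simp add: odd_dfact_Suc)
  finally show ?case .
qed auto

text \<open>The two end terms give the first constant. By log-convexity each interior term is at
  most \<open>odd_dfact (R + 1) * odd_dfact (n - R - 1)\<close>, and their number is absorbed by the
  last factor of \<open>odd_dfact (n - R)\<close>.\<close>

lemma odd_dfact_convolution_le:
  assumes "2 * R + 1 \<le> n"
  shows "(\<Sum>i=R..n-R. odd_dfact i * odd_dfact (n - i))
           \<le> (2 * odd_dfact R + odd_dfact (R + 1)) * odd_dfact (n - R)"
proof -
  let ?d = odd_dfact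
  have split: "{R..n-R} = {R, n-R} \<union> {R+1..n-R-1}"
    using assms by auto
  have "(\<Sum>i=R..n-R. ?d i * ?d (n - i)) =
          (\<Sum>i\<in>{R, n-R}. ?d i * ?d (n - i)) + (\<Sum>i=R+1..n-R-1. ?d i * ?d (n - i))"
    unfolding split using assms by (intro sum.union_disjoint) auto
  also have "(\<Sum>i\<in>{R, n-R}. ?d i * ?d (n - i)) = 2 * ?d R * ?d (n - R)"
    using assms by auto
  also have "(\<Sum>i=R+1..n-R-1. ?d i * ?d (n - i))
               \<le> (\<Sum>i=R+1..n-R-1. ?d (R + 1) * ?d (n - R - 1))"
  proof (rule sum_mono)
    fix i assume i: "i \<in> {R+1..n-R-1}"
    then show "?d i * ?d (n - i) \<le> ?d (R + 1) * ?d (n - R - 1)"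
      using odd_dfact_mult_le[of "R + 1" "n - i" "i - (R + 1)"] assms by auto
  qed
  also have "\<dots> = real (n - R - 1 - R) * (?d (R + 1) * ?d (n - R - 1))"
    by simp
  also have "\<dots> \<le> (2 * real (n - R - 1) + 1) * (?d (R + 1) * ?d (n - R - 1))"
    by (intro mult_right_mono) auto
  also have "\<dots> = ?d (R + 1) * ?d (n - R)"
    using assms odd_dfact_Suc[of "n - R - 1"] by (simp add: Suc_diff_Suc)
  finally show ?thesis by (simp add: algebra_simps)
qed

section \<open>Closure properties of factorially divergent power series\<close>

text \<open>As \<open>2^(m + 1/2) * Gamma (m + 1/2) = sqrt (2 * pi) * odd_dfact m\<close>, this is
  the expansion with A = 1/2 and \<beta> = 1/2, cut off at order \<open>R\<close>: \<open>G\<close>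
  stands for sqrt(2 pi hbar) times the image of \<open>F\<close> under the asymptotic operator.
  Truncation in \<open>n - k\<close> affects only finitely many \<open>n\<close>.\<close>

definition fact_asymp :: "nat \<Rightarrow> real fps \<Rightarrow> real fps \<Rightarrow> bool"
  where "fact_asymp R F G \<longleftrightarrow>
    (\<lambda>n. F $ n - (\<Sum>k<R. G $ k * odd_dfact (n - k))) \<in> O(\<lambda>n. odd_dfact (n - R))"

lemma odd_dfact_shift_bigo:
  assumes "S \<le> R" shows "(\<lambda>n. odd_dfact (n - R)) \<in> O(\<lambda>n. odd_dfact (n - S))"
  using assms by (intro bigoI[of _ 1] always_eventually) (auto intro!: odd_dfact_mono)

lemma bigo_nat_shift:
  fixes f g :: "nat \<Rightarrow> real"
  assumes "f \<in> O(g)" shows "(\<lambda>n. f (n - i)) \<in> O(\<lambda>n. g (n - i))"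
  using landau_o.big.compose[OF assms, of "\<lambda>n. n - i" sequentially]
  by (simp add: filterlim_minus_const_nat_at_top)

lemma bigo_sequence_cong:
  fixes f f' g :: "nat \<Rightarrow> real"
  assumes "f \<in> O(g)" "\<And>n. n \<ge> N \<Longrightarrow> f' n = f n"
  shows "f' \<in> O(g)"
proof -
  have "eventually (\<lambda>n. f' n = f n) sequentially"
    using eventually_ge_at_top[of N] by eventually_elim (rule assms(2))
  with assms(1) show ?thesis using landau_o.big.in_cong by blast
qed

lemma fact_asymp_mono:
  assumes "fact_asymp R F G" "S \<le> R"
  shows "fact_asymp S F G"
proof -
  have eq: "(\<Sum>k<R. G $ k * odd_dfact (n - k)) =
          (\<Sum>k<S. G $ k * odd_dfact (n - k)) + (\<Sum>k=S..<R. G $ k * odd_dfact (n - k))" for n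
    using assms(2) by (metis (no_types, lifting) atLeast0LessThan le0 sum.atLeastLessThan_concat)
  have "(\<lambda>n. \<Sum>k=S..<R. G $ k * odd_dfact (n - k)) \<in> O(\<lambda>n. odd_dfact (n - S))"
  proof (intro big_sum_in_bigo)
    fix k assume "k \<in> {S..<R}"
    then show "(\<lambda>n. G $ k * odd_dfact (n - k)) \<in> O(\<lambda>n. odd_dfact (n - S))"
      using odd_dfact_shift_bigo[of S k] by simp
  qed
  moreover have "(\<lambda>n. F $ n - (\<Sum>k<R. G $ k * odd_dfact (n - k))) \<in> O(\<lambda>n. odd_dfact (n - S))"
    using assms landau_o.big_trans odd_dfact_shift_bigo unfolding fact_asymp_def by blast
  ultimately have "(\<lambda>n. (F $ n - (\<Sum>k<R. G $ k * odd_dfact (n - k)))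
       + (\<Sum>k=S..<R. G $ k * odd_dfact (n - k))) \<in> O(\<lambda>n. odd_dfact (n - S))"
    using sum_in_bigo(1) by blast
  then show ?thesis unfolding fact_asymp_def eq by (simp add: algebra_simps)
qed

lemma fact_asymp_cong:
  assumes "fact_asymp R F G" "\<And>k. k < R \<Longrightarrow> G $ k = H $ k"
  shows "fact_asymp R F H"
  using assms by (simp add: fact_asymp_def)

text \<open>Convolution sums need a bound at every index; the finitely many exceptions fit into the
  constant because \<open>odd_dfact n\<close> is at least 1.\<close>

lemma fact_asymp_bound:
  assumes "fact_asymp R F G"
  obtains C where "C > 0" "\<And>n. \<bar>F $ n\<bar> \<le> C * odd_dfact n"
proof -
  have "fact_asymp 0 F G" using fact_asymp_mono[OF assms] by simp
  then have "(\<lambda>n. F $ n) \<in> O(odd_dfact)" by (simp add: fact_asymp_def)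
  then obtain c N where c: "\<And>n. n \<ge> N \<Longrightarrow> \<bar>F $ n\<bar> \<le> c * odd_dfact n"
    unfolding bigo_def eventually_sequentially by auto
  define C where "C = \<bar>c\<bar> + 1 + (\<Sum>n<N. \<bar>F $ n\<bar>)"
  have "0 \<le> (\<Sum>n<N. \<bar>F $ n\<bar>)" by (rule sum_nonneg) simp
  then have "C > 0" "c \<le> C" unfolding C_def by linarith+
  moreover have "\<bar>F $ n\<bar> \<le> C * odd_dfact n" for n
  proof (cases "n < N")
    case True
    have "\<bar>F $ n\<bar> \<le> (\<Sum>n<N. \<bar>F $ n\<bar>)"
      using True by (intro member_le_sum) auto
    also have "\<dots> \<le> C" unfolding C_def by auto
    also have "\<dots> = C * odd_dfact 0" by simp
    also have "\<dots> \<le> C * odd_dfact n" using \<open>C > 0\<close> by (intro mult_left_mono odd_dfact_mono) auto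
    finally show ?thesis .
  next
    case False
    then have "\<bar>F $ n\<bar> \<le> c * odd_dfact n" using c by simp
    also have "\<dots> \<le> C * odd_dfact n"
      using \<open>c \<le> C\<close> by (intro mult_right_mono) auto
    finally show ?thesis .
  qed
  ultimately show ?thesis using that by blast
qed

lemma fact_asymp_0I:
  assumes "\<And>n. \<bar>F $ n\<bar> \<le> C * odd_dfact n"
  shows "fact_asymp 0 F G"
  unfolding fact_asymp_def using assms by (intro bigoI[of _ C]) auto

lemma fact_asymp_add:
  assumes "fact_asymp R F G" "fact_asymp R F' G'"
  shows "fact_asymp R (F + F') (G + G')"
  using sum_in_bigo(1)[OF assms[unfolded fact_asymp_def]]
  by (simp add: fact_asymp_def algebra_simps sum.distrib)

text \<open>The shift of the coefficients is matched by a shift of the expansion, so order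
  \<open>S\<close> for \<open>F\<close> gives order \<open>S + 1\<close> for the product.\<close>

lemma fact_asymp_fps_X_mult:
  assumes "\<And>R. fact_asymp R F G"
  shows "fact_asymp R (fps_X * F) (fps_X * G)"
proof -
  have main: "fact_asymp (Suc S) (fps_X * F) (fps_X * G)" for S
  proof -
    have F: "(\<lambda>n. F $ (n - 1) - (\<Sum>k<S. G $ k * odd_dfact (n - 1 - k))) \<in> O(\<lambda>n. odd_dfact (n - 1 - S))"
      using bigo_nat_shift[OF assms[of S, unfolded fact_asymp_def], of 1] .
    have "(\<Sum>k<Suc S. (fps_X * G) $ k * odd_dfact (n - k)) =
          (\<Sum>k<S. G $ k * odd_dfact (n - 1 - k))" for n
      by (subst sum.lessThan_Suc_shift) simp
    then show ?thesis
      unfolding fact_asymp_def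
      using bigo_sequence_cong[OF F, of 1 "\<lambda>n. (fps_X * F) $ n - (\<Sum>k<Suc S. (fps_X * G) $ k * odd_dfact (n - k))"]
      by (simp del: sum.lessThan_Suc)
  qed
  show ?thesis using fact_asymp_mono[OF main[of R], of R] by simp
qed

text \<open>
  The large coefficients of a product come from one factor having low order; the middle part of
  the convolution is smaller by \<open>odd_dfact_convolution_le\<close>.
\<close>
lemma fact_asymp_mult:
  assumes "fact_asymp R F G" "fact_asymp R F' G'"
  shows "fact_asymp R (F * F') (F * G' + F' * G)"
proof -
  let ?d = odd_dfact
  obtain C where C: "C > 0" "\<And>n. \<bar>F $ n\<bar> \<le> C * ?d n" using fact_asymp_bound[OF assms(1)] by blast
  obtain C' where C': "C' > 0" "\<And>n. \<bar>F' $ n\<bar> \<le> C' * ?d n" using fact_asymp_bound[OF assms(2)] by blast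
  \<comment> \<open>Low coefficients of one factor \<open>P\<close> against high coefficients of the
    other factor \<open>Q\<close>; applied with both assignments of the roles.\<close>
  have half: "(\<lambda>n. (\<Sum>i<R. P $ i * Q $ (n - i)) - (\<Sum>k<R. (P * H) $ k * ?d (n - k)))
                \<in> O(\<lambda>n. ?d (n - R))" if "fact_asymp R Q H" for P Q H
  proof -
    \<comment> \<open>Order \<open>R - i\<close> is enough for \<open>Q\<close> here, since the
      shift by \<open>i\<close> supplies the remaining orders.\<close>
    have "(\<lambda>n. P $ i * (Q $ (n - i) - (\<Sum>k<R - i. H $ k * ?d (n - i - k)))) \<in> O(\<lambda>n. ?d (n - R))"
      if "i < R" for i
    proof -
      have "(\<lambda>n. Q $ (n - i) - (\<Sum>k<R - i. H $ k * ?d (n - i - k))) \<in> O(\<lambda>n. ?d (n - i - (R - i)))"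
        using bigo_nat_shift[OF fact_asymp_mono[OF \<open>fact_asymp R Q H\<close>, of "R - i", unfolded fact_asymp_def], of i]
        by simp
      with that show ?thesis by (simp add: landau_o.big.cmult_in_iff')
    qed
    then have "(\<lambda>n. \<Sum>i<R. P $ i * (Q $ (n - i) - (\<Sum>k<R - i. H $ k * ?d (n - i - k)))) \<in> O(\<lambda>n. ?d (n - R))"
      by (intro big_sum_in_bigo) auto
    moreover have "(\<Sum>i<R. P $ i * (\<Sum>k<R - i. H $ k * ?d (n - i - k))) =
          (\<Sum>k<R. (P * H) $ k * ?d (n - k))" for n
    proof -
      have "(\<Sum>k<R. (P * H) $ k * ?d (n - k)) = (\<Sum>k<R. \<Sum>i\<le>k. P $ i * H $ (k - i) * ?d (n - k))"
        by (simp add: fps_mult_nth sum_distrib_right atLeast0AtMost)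
      also have "\<dots> = (\<Sum>(k,i)\<in>(SIGMA k:{..<R}. {..k}). P $ i * H $ (k - i) * ?d (n - k))"
        by (simp add: sum.Sigma)
      also have "\<dots> = (\<Sum>(i,k)\<in>(SIGMA i:{..<R}. {..<R - i}). P $ i * (H $ k * ?d (n - i - k)))"
        by (rule sum.reindex_bij_witness[of _ "\<lambda>(i,k). (i + k, i)" "\<lambda>(k,i). (i, k - i)"])
           (auto simp: mult.assoc)
      also have "\<dots> = (\<Sum>i<R. P $ i * (\<Sum>k<R - i. H $ k * ?d (n - i - k)))"
        by (simp add: sum.Sigma sum_distrib_left)
      finally show ?thesis ..
    qed
    ultimately show ?thesis by (simp add: right_diff_distrib sum_subtractf)
  qed
  define M where "M n = (\<Sum>i=R..n-R. F $ i * F' $ (n - i))" for n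
  have M: "M \<in> O(\<lambda>n. ?d (n - R))"
  proof (rule bigoI[of _ "C * C' * (2 * ?d R + ?d (R + 1))"])
    show "\<forall>\<^sub>F n in sequentially. norm (M n) \<le> C * C' * (2 * ?d R + ?d (R + 1)) * norm (?d (n - R))"
      using eventually_ge_at_top[of "2 * R + 1"]
    proof eventually_elim
      case (elim n)
      have "\<bar>M n\<bar> \<le> (\<Sum>i=R..n-R. \<bar>F $ i * F' $ (n - i)\<bar>)" unfolding M_def by (rule sum_abs)
      also have "\<dots> \<le> (\<Sum>i=R..n-R. (C * ?d i) * (C' * ?d (n - i)))"
        unfolding abs_mult using C C' by (intro sum_mono mult_mono) (auto intro: mult_nonneg_nonneg less_imp_le)
      also have "\<dots> = C * C' * (\<Sum>i=R..n-R. ?d i * ?d (n - i))"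
        by (simp add: sum_distrib_left mult_ac)
      also have "\<dots> \<le> C * C' * ((2 * ?d R + ?d (R + 1)) * ?d (n - R))"
        using C C' elim by (intro mult_left_mono odd_dfact_convolution_le) auto
      finally show ?case by (simp add: mult_ac)
    qed
  qed
  \<comment> \<open>From \<open>2 * R + 1\<close> on, the two ranges in which one index is below
    \<open>R\<close> are disjoint, so every term is counted once.\<close>
  have split: "(F * F') $ n = (\<Sum>i<R. F $ i * F' $ (n - i)) + (\<Sum>i<R. F' $ i * F $ (n - i)) + M n"
    if n: "n \<ge> 2 * R + 1" for n
  proof -
    have "{0..n} = {..<R} \<union> {R..n-R} \<union> {n-R<..n}" using n by auto
    then have "(F * F') $ n = (\<Sum>i\<in>{..<R} \<union> {R..n-R} \<union> {n-R<..n}. F $ i * F' $ (n - i))"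
      by (simp add: fps_mult_nth)
    also have "\<dots> = (\<Sum>i<R. F $ i * F' $ (n - i)) + M n + (\<Sum>i\<in>{n-R<..n}. F $ i * F' $ (n - i))"
      using n unfolding M_def by (subst sum.union_disjoint; auto simp: sum.union_disjoint ivl_disj_int)+
    also have "(\<Sum>i\<in>{n-R<..n}. F $ i * F' $ (n - i)) = (\<Sum>i<R. F' $ i * F $ (n - i))"
      using n by (intro sum.reindex_bij_witness[of _ "\<lambda>i. n - i" "\<lambda>i. n - i"]) auto
    finally show ?thesis by simp
  qed
  have "(\<lambda>n. ((\<Sum>i<R. F $ i * F' $ (n - i)) - (\<Sum>k<R. (F * G') $ k * ?d (n - k)))
      + ((\<Sum>i<R. F' $ i * F $ (n - i)) - (\<Sum>k<R. (F' * G) $ k * ?d (n - k))) + M n) \<in> O(\<lambda>n. ?d (n - R))"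
    by (intro sum_in_bigo half assms M)
  then show ?thesis
    unfolding fact_asymp_def
    by (rule bigo_sequence_cong[of _ _ "2 * R + 1"])
       (simp add: split sum.distrib algebra_simps)
qed

text \<open>In the recursion for the coefficients of \<open>1/h\<close> the interior convolution is
  only of size \<open>odd_dfact (n - 1)\<close>, smaller than \<open>odd_dfact n\<close> by a factor
  of order \<open>n\<close>. Hence an induction closes once \<open>n\<close> is large.\<close>

lemma fps_inverse_bound:
  fixes h :: "real fps"
  assumes h0: "h $ 0 = 1" and h: "fact_asymp R h g"
  shows "fact_asymp 0 (inverse h) w"
proof -
  let ?d = odd_dfact
  define u where "u = inverse h"
  obtain C where C: "C > 0" "\<And>n. \<bar>h $ n\<bar> \<le> C * ?d n" using fact_asymp_bound[OF h] by blast
  have hu: "h * u = 1" unfolding u_def using h0 by (simp add: inverse_mult_eq_1')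
  have u0: "u $ 0 = 1" unfolding u_def using h0 by simp
  have rec: "u $ n = - h $ n - (\<Sum>i=1..n-1. h $ i * u $ (n - i))" if n: "n \<ge> 1" for n
  proof -
    have "{0..n} = insert 0 (insert n {1..n-1})" using n by auto
    then have "(h * u) $ n = h $ 0 * u $ n + (h $ n * u $ 0 + (\<Sum>i=1..n-1. h $ i * u $ (n - i)))"
      using n by (simp only: fps_mult_nth) simp
    then show ?thesis using n by (simp add: hu h0 u0)
  qed
  \<comment> \<open>The convolution estimate for \<open>R = 1\<close> has constant 2 * 1 + 3 = 5, so
    the interior sum takes at most half of the bound when 10 C is at most 2n - 1. The summand 3
    provides \<open>2 * R + 1 \<le> n\<close>.\<close>
  define N where "N = nat \<lceil>10 * C\<rceil> + 3"
  have N: "real N \<ge> 10 * C" "N \<ge> 3" unfolding N_def by linarith+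
  \<comment> \<open>The part \<open>2 * C\<close> lets \<open>h $ n\<close> fit into the other half
    of the bound; the finite sum starts the induction.\<close>
  define C' where "C' = 2 * C + 1 + (\<Sum>n<N. \<bar>u $ n\<bar>)"
  have C'2: "C' \<ge> 2 * C" "C' > 0" unfolding C'_def using C(1) by (simp_all add: sum_nonneg add_pos_nonneg add.assoc)
  have bound: "\<bar>u $ n\<bar> \<le> C' * ?d n" for n
  proof (induction n rule: less_induct)
    case (less n)
    show ?case
    proof (cases "n < N")
      case True
      have "\<bar>u $ n\<bar> \<le> (\<Sum>n<N. \<bar>u $ n\<bar>)" using True by (intro member_le_sum) auto
      also have "\<dots> \<le> C'" unfolding C'_def using C(1) by auto
      also have "\<dots> = C' * ?d 0" by simp
      also have "\<dots> \<le> C' * ?d n" using C'2 by (intro mult_left_mono odd_dfact_mono) auto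
      finally show ?thesis .
    next
      case False
      then have n: "n \<ge> 3" "real n \<ge> 10 * C" using N by auto
      have "\<bar>\<Sum>i=1..n-1. h $ i * u $ (n - i)\<bar> \<le> (\<Sum>i=1..n-1. \<bar>h $ i * u $ (n - i)\<bar>)" by (rule sum_abs)
      also have "\<dots> \<le> (\<Sum>i=1..n-1. (C * ?d i) * (C' * ?d (n - i)))"
        unfolding abs_mult using C n by (intro sum_mono mult_mono less) (auto intro: mult_nonneg_nonneg less_imp_le)
      also have "\<dots> = C * C' * (\<Sum>i=1..n-1. ?d i * ?d (n - i))"
        by (simp add: sum_distrib_left mult_ac)
      also have "\<dots> \<le> C * C' * ((2 * ?d 1 + ?d (1 + 1)) * ?d (n - 1))"
        using C C'2 n by (intro mult_left_mono odd_dfact_convolution_le) auto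
      also have "\<dots> = C' / 2 * (10 * C) * ?d (n - 1)"
        by (simp add: odd_dfact_Suc numeral_2_eq_2)
      also have "\<dots> \<le> C' / 2 * (2 * real (n - 1) + 1) * ?d (n - 1)"
        using n C'2 by (intro mult_right_mono mult_left_mono) auto
      also have "\<dots> = C' / 2 * ?d n"
        using n odd_dfact_Suc[of "n - 1"] by simp
      finally have "\<bar>\<Sum>i=1..n-1. h $ i * u $ (n - i)\<bar> \<le> C' / 2 * ?d n" .
      moreover have "\<bar>h $ n\<bar> \<le> C' / 2 * ?d n"
        by (rule order.trans[OF C(2) mult_right_mono]) (use C'2 in auto)
      moreover have "\<bar>u $ n\<bar> \<le> \<bar>h $ n\<bar> + \<bar>\<Sum>i=1..n-1. h $ i * u $ (n - i)\<bar>"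
        using rec[of n] n by simp
      ultimately show ?thesis by linarith
    qed
  qed
  show ?thesis using fact_asymp_0I[OF bound] unfolding u_def .
qed

text \<open>
  The series \<open>v\<close> has the expected asymptotics by construction and agrees with \<open>u = 1/h\<close> up to order
  \<open>R\<close>.  Then the asymptotic terms of \<open>h v\<close> cancel, so that \<open>e = 1 - h v = O(\<hbar>\<^sup>R)\<close> has small
  coefficients, and so has \<open>u - v = u e\<close>.
\<close>
lemma fact_asymp_inverse:
  fixes h :: "real fps"
  assumes h0: "h $ 0 = 1" and h: "fact_asymp R h g"
  shows "fact_asymp R (inverse h) (- g * inverse h ^ 2)"
proof -
  let ?d = odd_dfact
  define u where "u = inverse h"
  define c where "c = - g * u ^ 2"
  define v where "v = Abs_fps (\<lambda>n. if n < R then u $ n else \<Sum>k<R. c $ k * ?d (n - k))"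
  have hu: "h * u = 1" unfolding u_def using h0 by (simp add: inverse_mult_eq_1')
  have v: "fact_asymp R v c"
    unfolding fact_asymp_def
    by (rule bigo_sequence_cong[of "\<lambda>_. 0" _ R]) (simp_all add: v_def)
  \<comment> \<open>The product rule gives the expansion \<open>h * c + v * g = g * (v - u)\<close>,
    which vanishes below order \<open>R\<close> because \<open>u\<close> and \<open>v\<close> agree
    there.\<close>
  have hv: "fact_asymp R (h * v) 0"
  proof (rule fact_asymp_cong[OF fact_asymp_mult[OF h v]])
    fix k assume k: "k < R"
    have "h * c + v * g = - (h * u) * (u * g) + v * g"
      unfolding c_def by (simp add: power2_eq_square algebra_simps)
    then have "h * c + v * g = g * (v - u)" by (simp add: hu algebra_simps)
    also have "\<dots> $ k = 0"
      unfolding fps_mult_nth using k by (intro sum.neutral) (auto simp: v_def)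
    finally show "(h * c + v * g) $ k = 0 $ k" by simp
  qed
  define e where "e = 1 - h * v"
  have e_small: "(\<lambda>n. e $ n) \<in> O(\<lambda>n. ?d (n - R))"
  proof -
    have "(\<lambda>n. - ((h * v) $ n)) \<in> O(\<lambda>n. ?d (n - R))"
      using hv unfolding fact_asymp_def by simp
    then show ?thesis by (rule bigo_sequence_cong[of _ _ 1]) (simp add: e_def)
  qed
  have e_eq: "e = h * (u - v)" unfolding e_def by (simp add: hu algebra_simps)
  have e_low: "e $ k = 0" if "k < R" for k
    unfolding e_eq fps_mult_nth using that by (intro sum.neutral) (auto simp: v_def)
  define e' where "e' = fps_shift R e"
  have e': "e = fps_X ^ R * e'"
    unfolding e'_def by (rule fps_ext) (simp add: fps_X_power_mult_nth e_low)
  have "(\<lambda>n. e $ (n + R)) \<in> O(\<lambda>n. ?d (n + R - R))"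
    using landau_o.big.compose[OF e_small, of "\<lambda>n. n + R" sequentially]
    by (simp add: filterlim_add_const_nat_at_top)
  \<comment> \<open>With the factor X^R removed, a bound at order 0 suffices, and it survives
    multiplication by \<open>u\<close>.\<close>
  then have "fact_asymp 0 e' 0" unfolding fact_asymp_def e'_def by simp
  then have "fact_asymp 0 (u * e') 0"
    using fact_asymp_mono[OF fact_asymp_mult[OF fps_inverse_bound[OF h0 h]], of e' 0 0]
    by (simp add: u_def fact_asymp_def)
  then have ue: "(\<lambda>n. (u * e') $ (n - R)) \<in> O(\<lambda>n. ?d (n - R))"
    using bigo_nat_shift[of "\<lambda>n. (u * e') $ n" ?d R] by (simp add: fact_asymp_def)
  have uv: "u - v = fps_X ^ R * (u * e')"
  proof -
    have "u - v = u * e" unfolding e_eq using hu by (metis mult.assoc mult.commute mult_1)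
    then show ?thesis by (simp add: e' mult_ac)
  qed
  have "(\<lambda>n. (u - v) $ n) \<in> O(\<lambda>n. ?d (n - R))"
    using ue by (rule bigo_sequence_cong[of _ _ R]) (simp add: uv fps_X_power_mult_nth)
  then have "fact_asymp R (u - v) 0" by (simp add: fact_asymp_def)
  from fact_asymp_add[OF this v] show ?thesis by (simp add: u_def c_def)
qed

section \<open>Factorially divergent Laurent series\<close>

text \<open>Both series carry the same pole factor, so \<open>g\<close> is again sqrt(2 pi hbar)
  times the asymptotic expansion of \<open>f\<close>. As \<open>N\<close> can be raised, two such
  pairs have a common denominator.\<close>

definition laurent_asymp :: "real fls \<Rightarrow> real fls \<Rightarrow> bool"
  where "laurent_asymp f g \<longleftrightarrow>
    (\<exists>N F G. f = fls_X_inv ^ N * fps_to_fls F \<and> g = fls_X_inv ^ N * fps_to_fls G \<and>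
       (\<forall>R. fact_asymp R F G))"

lemma fls_X_inv_times_X [simp]: "fls_X_inv * fls_X = (1 :: real fls)" "fls_X * fls_X_inv = (1 :: real fls)"
  by (simp_all add: fls_X_inv_times_conv_shift)

lemma fls_X_inv_power_times_X_power: "fls_X_inv ^ k * fls_X ^ k = (1 :: real fls)"
  by (simp flip: power_mult_distrib)

lemma fact_asymp_fps_X_power_mult:
  assumes "\<And>R. fact_asymp R F G"
  shows "fact_asymp R (fps_X ^ k * F) (fps_X ^ k * G)"
proof (induction k arbitrary: R)
  case (Suc k)
  show ?case using fact_asymp_fps_X_mult[OF Suc, of R] by (simp add: mult_ac)
qed (use assms in simp)

lemma fls_X_inv_power_raise:
  "fls_X_inv ^ N * fps_to_fls F = fls_X_inv ^ (N + k) * fps_to_fls (fps_X ^ k * F :: real fps)"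
proof -
  have "fls_X_inv ^ (N + k) * fps_to_fls (fps_X ^ k * F) =
          fls_X_inv ^ N * (fls_X_inv ^ k * fls_X ^ k) * fps_to_fls F"
    by (simp add: fls_times_fps_to_fls fps_to_fls_power power_add mult_ac)
  then show ?thesis by (simp add: fls_X_inv_power_times_X_power)
qed

lemma laurent_asymp_add:
  assumes "laurent_asymp f g" "laurent_asymp f' g'"
  shows "laurent_asymp (f + f') (g + g')"
proof -
  obtain N F G where 1: "f = fls_X_inv ^ N * fps_to_fls F" "g = fls_X_inv ^ N * fps_to_fls G"
    "\<And>R. fact_asymp R F G" using assms(1) unfolding laurent_asymp_def by blast
  obtain N' F' G' where 2: "f' = fls_X_inv ^ N' * fps_to_fls F'" "g' = fls_X_inv ^ N' * fps_to_fls G'"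
    "\<And>R. fact_asymp R F' G'" using assms(2) unfolding laurent_asymp_def by blast
  have "f + f' = fls_X_inv ^ (N + N') * fps_to_fls (fps_X ^ N' * F + fps_X ^ N * F')"
    unfolding 1(1) 2(1) fls_X_inv_power_raise[of N F N'] fls_X_inv_power_raise[of N' F' N]
    by (simp add: distrib_left add.commute)
  moreover have "g + g' = fls_X_inv ^ (N + N') * fps_to_fls (fps_X ^ N' * G + fps_X ^ N * G')"
    unfolding 1(2) 2(2) fls_X_inv_power_raise[of N G N'] fls_X_inv_power_raise[of N' G' N]
    by (simp add: distrib_left add.commute)
  moreover have "fact_asymp R (fps_X ^ N' * F + fps_X ^ N * F') (fps_X ^ N' * G + fps_X ^ N * G')" for R
    by (intro fact_asymp_add fact_asymp_fps_X_power_mult 1 2)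
  ultimately show ?thesis unfolding laurent_asymp_def by blast
qed

lemma laurent_asymp_mult:
  assumes "laurent_asymp f g" "laurent_asymp f' g'"
  shows "laurent_asymp (f * f') (f * g' + f' * g)"
proof -
  obtain N F G where 1: "f = fls_X_inv ^ N * fps_to_fls F" "g = fls_X_inv ^ N * fps_to_fls G"
    "\<And>R. fact_asymp R F G" using assms(1) unfolding laurent_asymp_def by blast
  obtain N' F' G' where 2: "f' = fls_X_inv ^ N' * fps_to_fls F'" "g' = fls_X_inv ^ N' * fps_to_fls G'"
    "\<And>R. fact_asymp R F' G'" using assms(2) unfolding laurent_asymp_def by blast
  have "f * f' = fls_X_inv ^ (N + N') * fps_to_fls (F * F')"
    unfolding 1 2 by (simp add: fls_times_fps_to_fls power_add mult_ac)
  moreover have "f * g' + f' * g = fls_X_inv ^ (N + N') * fps_to_fls (F * G' + F' * G)"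
    unfolding 1 2 by (simp add: fls_times_fps_to_fls power_add algebra_simps)
  moreover have "fact_asymp R (F * F') (F * G' + F' * G)" for R
    by (intro fact_asymp_mult 1 2)
  ultimately show ?thesis unfolding laurent_asymp_def by blast
qed

lemma laurent_asymp_0: "laurent_asymp 0 0"
  unfolding laurent_asymp_def by (intro exI[of _ 0] exI[of _ "0 :: real fps"]) (simp add: fact_asymp_def)

lemma laurent_asymp_sum:
  assumes "\<And>i. i \<in> A \<Longrightarrow> laurent_asymp (f i) (g i)"
  shows "laurent_asymp (\<Sum>i\<in>A. f i) (\<Sum>i\<in>A. g i)"
  using assms by (induction A rule: infinite_finite_induct) (auto intro: laurent_asymp_add laurent_asymp_0)

lemma laurent_asymp_monomial: "laurent_asymp (fls_const c * fls_X_inv ^ N) 0"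
proof -
  have "fact_asymp R (fps_const c) 0" for R
  proof -
    have "(\<lambda>n. fps_const c $ n) \<in> O(\<lambda>n. odd_dfact (n - R))"
      by (rule bigo_sequence_cong[of "\<lambda>_. 0" _ 1]) simp_all
    then show ?thesis by (simp add: fact_asymp_def)
  qed
  then show ?thesis unfolding laurent_asymp_def
    by (intro exI[of _ N] exI[of _ "fps_const c"] exI[of _ "0 :: real fps"]) (simp add: mult.commute)
qed

lemma laurent_asymp_monomial_mult:
  assumes "laurent_asymp f g"
  shows "laurent_asymp (fls_const c * fls_X_inv ^ N * f) (fls_const c * fls_X_inv ^ N * g)"
  using laurent_asymp_mult[OF laurent_asymp_monomial assms, of c N] by simp

lemma laurent_asymp_const_mult:
  assumes "laurent_asymp f g"
  shows "laurent_asymp (fls_const c * f) (fls_const c * g)"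
  using laurent_asymp_monomial_mult[OF assms, of c 0] by simp

lemma laurent_asymp_minus:
  assumes "laurent_asymp f g"
  shows "laurent_asymp (- f) (- g)"
proof -
  have "fls_const (- 1 :: real) = - 1" by (simp add: fls_eq_iff)
  then show ?thesis using laurent_asymp_const_mult[OF assms, of "- 1"] by simp
qed

section \<open>From double factorials to Gamma functions\<close>

lemma Gamma_half_integer: "Gamma (real n + 1/2) = sqrt pi * odd_dfact n / 2 ^ n"
proof (induction n)
  case (Suc n)
  have "Gamma (real (Suc n) + 1/2) = (real n + 1/2) * Gamma (real n + 1/2)"
    using Gamma_plus1[of "real n + 1/2"]
    by (smt (verit, best) add.assoc add.commute nonpos_Ints_nonpos of_nat_0_le_iff of_nat_Suc zero_less_divide_1_iff)
  also have "\<dots> = sqrt pi * odd_dfact (Suc n) / 2 ^ Suc n"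
    unfolding Suc by (simp add: odd_dfact_Suc field_simps)
  finally show ?case .
qed (simp add: Gamma_one_half_real)

text \<open>Needed because the pole order of a series enters the exponent \<beta>, whereas the final
  expansions are stated with fixed exponents.\<close>

lemma hbar_powr_times_shift:
  "hbar_powr_times (\<alpha> - real N) L = hbar_powr_times \<alpha> (fls_X_inv ^ N * L)"
proof
  fix e :: real
  have eq: "e - (\<alpha> - real N) = (e - \<alpha>) + real N" by simp
  have int: "e - \<alpha> + real N \<in> \<int> \<longleftrightarrow> e - \<alpha> \<in> \<int>"
    by (metis Ints_add Ints_diff Ints_of_nat add_diff_cancel_right')
  have "\<lfloor>(e - \<alpha>) + real N\<rfloor> = \<lfloor>e - \<alpha>\<rfloor> + int N" by linarith
  then show "hbar_powr_times (\<alpha> - real N) L e = hbar_powr_times \<alpha> (fls_X_inv ^ N * L) e"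
    unfolding hbar_powr_times_def eq int by (simp add: fls_X_inv_power_times_conv_shift)
qed

lemma laurent_asymp_imp_has_factorial_asymptotics:
  assumes "laurent_asymp f g"
  shows "has_factorial_asymptotics (1/2) f
           (hbar_powr_times (- 1/2) (fls_const (1 / sqrt (2 * pi)) * g))"
proof -
  obtain N F G where f: "f = fls_X_inv ^ N * fps_to_fls F" and g: "g = fls_X_inv ^ N * fps_to_fls G"
    and FG: "\<And>R. fact_asymp R F G" using assms unfolding laurent_asymp_def by blast
  \<comment> \<open>The coefficient of index \<open>n\<close> in \<open>f\<close> is the one of
    index \<open>n + N\<close> in \<open>F\<close>, hence \<open>N\<close> is added to 1/2.\<close>
  define \<beta> where "\<beta> = 1/2 + real N"
  define c where "c k = G $ k / sqrt (2 * pi)" for k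
  have summand: "c k * (1/2) powr (- real n - \<beta> + real k) * Gamma (real n + \<beta> - real k) =
                G $ k * odd_dfact (n + N - k)" if "k \<le> n + N" for n k
  proof -
    define m where "m = n + N - k"
    have e: "- real n - \<beta> + real k = - (real m + 1/2)" "real n + \<beta> - real k = real m + 1/2"
      using that by (simp_all add: m_def \<beta>_def)
    have "(1/2 :: real) powr (- a) = 2 powr a" for a
      by (simp add: powr_minus powr_divide)
    then have "(1/2 :: real) powr (- (real m + 1/2)) = 2 powr (real m + 1/2)"
      by blast
    also have "\<dots> = 2 ^ m * sqrt 2"
      by (simp add: powr_add powr_realpow powr_half_sqrt)
    finally show ?thesis
      unfolding e Gamma_half_integer c_def m_def[symmetric] by (simp add: real_sqrt_mult)
  qed
  have "(\<lambda>n. f $$ int n - (\<Sum>k<R. c k * (1/2) powr (- real n - \<beta> + real k) * Gamma (real n + \<beta> - real k)))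
          \<in> O(\<lambda>n. (1/2) powr (- real n) * Gamma (real n + \<beta> - real R))" for R
  proof -
    have "(\<lambda>n. F $ (n + N) - (\<Sum>k<R. G $ k * odd_dfact (n + N - k))) \<in> O(\<lambda>n. odd_dfact (n + N - R))"
      using landau_o.big.compose[OF FG[of R, unfolded fact_asymp_def], of "\<lambda>n. n + N" sequentially]
      by (simp add: filterlim_add_const_nat_at_top)
    moreover have "F $ (n + N) = f $$ int n" for n
      unfolding f by (simp add: fls_X_inv_power_times_conv_shift nat_add_distrib)
    ultimately have 1: "(\<lambda>n. f $$ int n - (\<Sum>k<R. G $ k * odd_dfact (n + N - k)))
                        \<in> O(\<lambda>n. odd_dfact (n + N - R))" by simp
    have 2: "(\<lambda>n. odd_dfact (n + N - R)) \<in> O(\<lambda>n. (1/2) powr (- real n) * Gamma (real n + \<beta> - real R))"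
    \<comment> \<open>The constant compares \<open>2 ^ n\<close> with the power
      \<open>2 ^ (n + N - R)\<close> in the half-integer Gamma value.\<close>
    proof (rule bigoI[of _ "2 powr (real N - real R) / sqrt pi"])
      show "\<forall>\<^sub>F n in sequentially. norm (odd_dfact (n + N - R)) \<le> 2 powr (real N - real R) / sqrt pi *
              norm ((1/2) powr (- real n) * Gamma (real n + \<beta> - real R))"
        using eventually_ge_at_top[of R]
      proof eventually_elim
        case (elim n)
        define m where "m = n + N - R"
        have e: "real n + \<beta> - real R = real m + 1/2" "real N - real R = real m - real n"
          using elim by (simp_all add: m_def \<beta>_def)
        have "(1/2 :: real) powr (- real n) = 2 ^ n"
          by (simp add: powr_minus powr_divide powr_realpow)
        then show ?case
          unfolding e Gamma_half_integer m_def[symmetric]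
          by (simp add: powr_diff powr_realpow abs_mult)
      qed
    qed
    show ?thesis
      by (rule bigo_sequence_cong[OF landau_o.big_trans[OF 1 2], of R]) (simp add: summand)
  qed
  moreover have "hbar_powr_times (- 1/2) (fls_const (1 / sqrt (2 * pi)) * g) =
          hbar_powr_times (- \<beta>) (fps_to_fls (Abs_fps c))"
  proof -
    have "fls_const (1 / sqrt (2 * pi)) * fps_to_fls G = fps_to_fls (Abs_fps c)"
      by (simp add: fls_eq_iff c_def)
    then have "fls_const (1 / sqrt (2 * pi)) * g = fls_X_inv ^ N * fps_to_fls (Abs_fps c)"
      unfolding g by (metis mult.left_commute)
    then show ?thesis
      using hbar_powr_times_shift[of "- 1/2" N "fps_to_fls (Abs_fps c)"] by (simp add: \<beta>_def)
  qed
  ultimately show ?thesis unfolding has_factorial_asymptotics_def by fastforce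
qed

section \<open>First order of the partition function\<close>

text \<open>The equation expresses each coefficient through earlier ones. This uniqueness principle
  yields the closed forms of orders 0 and 1 of \<open>qqed_Z\<close>.\<close>

lemma fps_linear_ode_zero:
  fixes y :: "'a :: field_char_0 fps"
  assumes "fps_deriv y = r * y" "y $ 0 = 0"
  shows "y = 0"
proof -
  have "y $ n = 0" for n
  proof (induction n rule: less_induct)
    case (less n)
    show ?case
    proof (cases n)
      case (Suc m)
      have "of_nat (Suc m) * y $ Suc m = (r * y) $ m" by (simp flip: assms(1))
      also have "\<dots> = 0" unfolding fps_mult_nth using less Suc by (intro sum.neutral) auto
      finally show ?thesis using Suc by (simp del: of_nat_Suc)
    qed (use assms in simp)
  qed
  then show ?thesis by (simp add: fps_eq_iff)
qed

lemma exp_over_hbar_eq: "exp_over_hbar p = fps_exp fls_X_inv oo p"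
  by (simp only: exp_over_hbar_def divide_inverse fls_inverse_X mult_1)

lemma fps_deriv_exp_over_hbar:
  assumes "p $ 0 = 0"
  shows "fps_deriv (exp_over_hbar p) = fps_const fls_X_inv * fps_deriv p * exp_over_hbar p"
  using assms
  by (simp add: exp_over_hbar_eq fps_compose_deriv fps_const_mult_apply_left mult_ac)

lemma exp_over_hbar_nth_0: "exp_over_hbar p $ 0 = 1"
  by (simp add: exp_over_hbar_def)

text \<open>Both sides have constant term 1 and logarithmic derivative (p' + q') / hbar.\<close>

lemma exp_over_hbar_add:
  assumes "p $ 0 = 0" "q $ 0 = 0"
  shows "exp_over_hbar (p + q) = exp_over_hbar p * exp_over_hbar q"
proof -
  define y where "y = exp_over_hbar (p + q) - exp_over_hbar p * exp_over_hbar q"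
  have "fps_deriv y = fps_const fls_X_inv * fps_deriv (p + q) * y"
    using assms by (simp add: y_def fps_deriv_exp_over_hbar algebra_simps)
  moreover have "y $ 0 = 0" by (simp add: y_def exp_over_hbar_nth_0)
  ultimately have "y = 0" by (rule fps_linear_ode_zero)
  then show ?thesis by (simp add: y_def)
qed

lemma fps_const_hbar_cancel: "fps_const hbar * (fps_const fls_X_inv * x) = x"
  by (simp flip: mult.assoc)

lemma fps_const_hbar_mult_eqD:
  assumes "fps_const hbar * x = y" shows "x = fps_const fls_X_inv * y"
  unfolding assms[symmetric] by (simp flip: mult.assoc)

lemma half_plus_half: "rconst (1/2) + rconst (1/2) = 1"
  by (simp add: rconst_def fls_plus_const)

definition gaussian :: "real fls fps"
  where "gaussian = exp_over_hbar (rconst (1/2) * fps_X ^ 2)"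

lemma gaussian_deriv: "fps_const hbar * fps_deriv gaussian = fps_X * gaussian"
proof -
  have "fps_deriv (rconst (1/2) * fps_X ^ 2) = (rconst (1/2) + rconst (1/2)) * fps_X"
    by (simp add: power2_eq_square rconst_def algebra_simps)
  then have "fps_deriv (rconst (1/2) * fps_X ^ 2) = (fps_X :: real fls fps)"
    by (simp add: half_plus_half)
  then show ?thesis
    by (simp add: gaussian_def fps_deriv_exp_over_hbar fps_const_hbar_cancel mult.assoc)
qed

lemma gaussian_nth_0: "gaussian $ 0 = 1"
  by (simp add: gaussian_def exp_over_hbar_nth_0)

text \<open>The series \<open>\<Sum>n. \<hbar>\<^sup>n B\<^sub>n(j)\<close>.\<close>
definition fps_family :: "(nat \<Rightarrow> real fps) \<Rightarrow> real fls fps"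
  where "fps_family B = Abs_fps (\<lambda>l. fps_to_fls (Abs_fps (\<lambda>n. B n $ l)))"

lemma fps_family_diff: "fps_family B - fps_family C = fps_family (\<lambda>n. B n - C n)"
  by (simp add: fps_family_def fps_eq_iff fls_eq_iff)

lemma fps_family_X_mult: "fps_X * fps_family B = fps_family (\<lambda>n. fps_X * B n)"
  by (simp add: fps_family_def fps_eq_iff fls_eq_iff)

lemma fps_family_one_minus_X_mult: "(1 - fps_X) * fps_family B = fps_family (\<lambda>n. (1 - fps_X) * B n)"
  by (simp add: left_diff_distrib fps_family_X_mult fps_family_diff)

lemma fps_family_deriv: "fps_deriv (fps_family B) = fps_family (\<lambda>n. fps_deriv (B n))"
  by (simp add: fps_family_def fps_eq_iff fls_eq_iff fls_of_nat del: of_nat_Suc)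

lemma fps_family_hbar_mult:
  "fps_const hbar * fps_family B = fps_family (\<lambda>n. if n = 0 then 0 else B (n - 1))"
proof -
  have "hbar * fps_to_fls F = fps_to_fls (fps_X * F)" for F :: "real fps"
    by (simp add: fls_times_fps_to_fls)
  then show ?thesis
    by (auto simp add: fps_family_def fps_eq_iff)
qed

lemma fps_family_1: "fps_family (\<lambda>n. if n = 0 then 1 else 0) = 1"
  by (auto simp: fps_family_def fps_eq_iff fls_eq_iff)

text \<open>The series \<open>V\<close> of the introduction\<close>
definition free_W1 :: "real fls fps"
  where "free_W1 = chi_resc / (1 - fps_X)"

lemma chi_resc_eq: "chi_resc = fps_family (\<lambda>n. fps_const (odd_dfact n) * inverse (1 - fps_X) ^ (2 * n))"
  by (simp add: chi_resc_def hbar_rescale_def fps_family_def chi_def fps_inverse_power power_mult)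

lemma one_minus_X_inverse:
  "(1 - fps_X) * inverse (1 - fps_X) = (1 :: 'a :: field fps)"
  by (simp add: inverse_mult_eq_1')

lemma free_W1_times: "(1 - fps_X) * free_W1 = chi_resc"
  unfolding free_W1_def by (simp add: fps_divide_unit inverse_mult_eq_1' mult.left_commute)

lemma free_W1_eq: "free_W1 = fps_family (\<lambda>n. fps_const (odd_dfact n) * inverse (1 - fps_X) ^ (2 * n + 1))"
  (is "_ = ?V")
proof -
  let ?Y = "inverse (1 - fps_X) :: real fps"
  have "(1 - fps_X) * (c * ?Y ^ (2 * n + 1)) = ((1 - fps_X) * ?Y) * (c * ?Y ^ (2 * n))" for c n
    by (simp only: power_add power_one_right mult_ac)
  then have "(1 - fps_X) * ?V = chi_resc"
    unfolding fps_family_one_minus_X_mult chi_resc_eq one_minus_X_inverse mult_1 by presburger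
  then have "inverse (1 - fps_X) * ((1 - fps_X) * ?V) = free_W1"
    by (simp add: free_W1_def fps_divide_unit mult.commute)
  moreover have "inverse (1 - fps_X) * ((1 - fps_X) * ?V) = ((1 - fps_X) * inverse (1 - fps_X)) * ?V"
    by (simp only: mult_ac)
  ultimately show ?thesis unfolding one_minus_X_inverse by simp
qed

text \<open>The derivative of (1 - j)^(-2n-1) is (2n+1) (1 - j)^(-2n-2), which turns (2n-1)!! into
  (2n+1)!!. So the n-th term of hbar V' is the term of index n + 1 in (1 - j) V, and only the term
  of index 0 survives.\<close>

lemma free_W1_ode: "(1 - fps_X) * free_W1 - fps_const hbar * fps_deriv free_W1 = 1"
proof -
  let ?Y = "inverse (1 - fps_X) :: real fps"
  have dY: "fps_deriv ?Y = ?Y ^ 2"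
    by (simp add: fps_inverse_deriv)
  have 1: "(1 - fps_X) * free_W1 = fps_family (\<lambda>n. fps_const (odd_dfact n) * ?Y ^ (2 * n))"
    by (simp add: free_W1_times chi_resc_eq)
  have "fps_deriv (?Y ^ (2 * n + 1)) = fps_const (2 * real n + 1) * ?Y ^ (2 * Suc n)" for n
    by (subst fps_deriv_power) (simp add: dY power2_eq_square mult_ac)
  then have D: "fps_deriv (fps_const (odd_dfact n) * ?Y ^ (2 * n + 1)) =
      fps_const (odd_dfact (Suc n)) * ?Y ^ (2 * Suc n)" for n
    by (simp only: fps_deriv_mult_const_left odd_dfact_Suc fps_const_mult[symmetric] mult_ac)
  have 2: "fps_const hbar * fps_deriv free_W1 =
      fps_family (\<lambda>n. if n = 0 then 0 else fps_const (odd_dfact n) * ?Y ^ (2 * n))"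
    unfolding free_W1_eq fps_family_deriv fps_family_hbar_mult
    by (intro arg_cong[of _ _ fps_family] ext)
       (auto simp only: D gr0_conv_Suc diff_Suc_1 split: if_splits)
  show ?thesis
    unfolding 1 2 fps_family_diff by (subst fps_family_1[symmetric], rule arg_cong[of _ _ fps_family]) auto
qed

lemma free_W1_nth_0: "free_W1 $ 0 = fps_to_fls chi"
proof -
  have "free_W1 $ 0 = ((1 - fps_X) * free_W1) $ 0" by simp
  also have "\<dots> = fps_to_fls chi" unfolding free_W1_times chi_resc_eq
    by (simp add: fps_family_def chi_def fps_power_zeroth)
  finally show ?thesis .
qed

lemma gauss_integral_diff: "gauss_integral p - gauss_integral q = gauss_integral (p - q)"
  by (simp add: gauss_integral_def fls_eq_iff algebra_simps)

lemma qqed_Z_nth: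
  "qqed_Z $ m $ a = fls_const (1 / (fact a * fact m)) * fls_X_inv ^ (a + m)
             * gauss_integral (fps_X ^ a * inverse (1 - fps_X) ^ m)"
  by (simp add: qqed_Z_def divide_inverse fls_inverse_X)

text \<open>The operator hbar d/dj inserts a factor x under the integral.\<close>

lemma qqed_Z_nth_Suc:
  "of_nat (Suc a) * (hbar * qqed_Z $ m $ Suc a) =
     fls_const (1 / (fact a * fact m)) * fls_X_inv ^ (a + m)
             * gauss_integral (fps_X ^ Suc a * inverse (1 - fps_X) ^ m)"
proof -
  have "fls_const (1 / (fact a * fact m)) = of_nat (Suc a) * fls_const (1 / (fact (Suc a) * fact m) :: real)"
    by (simp add: fls_of_nat fls_const_mult_const field_simps del: of_nat_Suc)
  moreover have "hbar * (fls_X_inv ^ (Suc a + m) * x) = fls_X_inv ^ (a + m) * x" for x :: "real fls"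
    by (simp flip: mult.assoc)
  ultimately show ?thesis
    unfolding qqed_Z_nth by (simp add: mult.assoc mult.left_commute[of hbar] del: of_nat_Suc power_Suc)
qed

lemma gauss_integral_X_power_even: "gauss_integral (fps_X ^ (2 * n)) = fls_const (odd_dfact n) * hbar ^ n"
  by (auto simp: gauss_integral_def fls_eq_iff fls_X_power_nth split: if_splits)

text \<open>Integration by parts against the Gaussian weight, here read off from the recursion of
  the double factorials.\<close>

lemma gauss_integral_X_power_add_2:
  "gauss_integral (fps_X ^ (a + 2)) = fls_const (real (Suc a)) * hbar * gauss_integral (fps_X ^ a)"
proof (cases "even a")
  case True
  then obtain n where n: "a = 2 * n" by blast
  have c: "fls_const (odd_dfact (Suc n)) = fls_const (real (Suc (2 * n))) * fls_const (odd_dfact n)"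
    by (simp add: odd_dfact_Suc fls_const_mult_const add.commute)
  have m: "2 * n + 2 = 2 * Suc n" by simp
  show ?thesis
    unfolding n m gauss_integral_X_power_even
    by (simp only: c mult_ac power_Suc)
next
  case False
  then have "2 * n \<noteq> a" "2 * n \<noteq> a + 2" for n by presburger+
  then have "gauss_integral (fps_X ^ a) = 0" "gauss_integral (fps_X ^ (a + 2)) = 0"
    unfolding gauss_integral_def fls_eq_iff fps_X_power_nth by auto
  then show ?thesis by simp
qed

text \<open>The moment recursion gives hbar Z_0' = j Z_0, the equation of exp(j^2 / (2 hbar)), with
  the same initial value.\<close>

lemma qqed_Z_0: "qqed_Z $ 0 = gaussian"
proof -
  have "fps_const hbar * fps_deriv (qqed_Z $ 0) = fps_X * qqed_Z $ 0"
  proof (rule fps_ext)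
    fix a
    show "(fps_const hbar * fps_deriv (qqed_Z $ 0)) $ a = (fps_X * qqed_Z $ 0) $ a"
    proof (cases a)
      case 0
      have "gauss_integral fps_X = 0"
        by (auto simp: gauss_integral_def fls_eq_iff)
      then show ?thesis using qqed_Z_nth_Suc[of 0 0] by (simp add: 0 mult_ac)
    next
      case (Suc b)
      have r: "1 / fact (Suc b) * real (Suc b) = (1 / fact b :: real)"
        by (simp del: of_nat_Suc)
      have c: "fls_const (1 / fact (Suc b)) * fls_const (real (Suc b)) = fls_const (1 / fact b :: real)"
          by (simp only: fls_const_mult_const r)
      have "of_nat (Suc a) * (hbar * qqed_Z $ 0 $ Suc a) =
         (fls_const (1 / fact (Suc b)) * fls_const (real (Suc b))) * (fls_X_inv ^ Suc b * hbar) * gauss_integral (fps_X ^ b)"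
        unfolding qqed_Z_nth_Suc using gauss_integral_X_power_add_2[of b] by (simp add: Suc mult_ac del: of_nat_Suc fact_Suc)
      also have "\<dots> = qqed_Z $ 0 $ b"
        unfolding c qqed_Z_nth by (simp add: mult_ac)
      finally show ?thesis by (simp add: Suc mult_ac)
    qed
  qed
  then have "fps_const hbar * fps_deriv (qqed_Z $ 0 - gaussian) = fps_X * (qqed_Z $ 0 - gaussian)"
    by (simp add: gaussian_deriv right_diff_distrib)
  then have "fps_deriv (qqed_Z $ 0 - gaussian) = fps_const fls_X_inv * fps_X * (qqed_Z $ 0 - gaussian)"
    by (metis fps_const_hbar_mult_eqD mult.assoc)
  moreover have "gauss_integral 1 = 1" using gauss_integral_X_power_even[of 0] by simp
  then have "(qqed_Z $ 0 - gaussian) $ 0 = 0"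
    by (simp add: gaussian_nth_0 qqed_Z_nth)
  ultimately show ?thesis using fps_linear_ode_zero by (metis eq_iff_diff_eq_0)
qed

text \<open>
  Both sides solve \<open>y - \<hbar> y' = exp(j\<^sup>2/2\<hbar>) / \<hbar>\<close>; for the left side this is
  \<open>x\<^sup>a / (1 - x) - x\<^sup>a\<^sup>+\<^sup>1 / (1 - x) = x\<^sup>a\<close> under the integral.
\<close>
lemma qqed_Z_1: "qqed_Z $ 1 = fps_const fls_X_inv * gaussian * free_W1"
proof -
  let ?h = "fps_const hbar" and ?k = "fps_const fls_X_inv"
  define y where "y = ?k * gaussian * free_W1"
  have Z: "qqed_Z $ 1 - ?h * fps_deriv (qqed_Z $ 1) = ?k * gaussian"
  proof (rule fps_ext)
    fix a
    have "fps_X ^ a * inverse (1 - fps_X) - fps_X ^ Suc a * inverse (1 - fps_X) =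
            fps_X ^ a * ((1 - fps_X) * inverse (1 - fps_X :: real fps))"
      by (simp add: algebra_simps)
    then have p: "fps_X ^ a * inverse (1 - fps_X) - fps_X ^ Suc a * inverse (1 - fps_X) = (fps_X ^ a :: real fps)"
      by (simp add: one_minus_X_inverse)
    have "(qqed_Z $ 1 - ?h * fps_deriv (qqed_Z $ 1)) $ a
        = qqed_Z $ 1 $ a - of_nat (Suc a) * (hbar * qqed_Z $ 1 $ Suc a)"
      by (simp add: mult_ac)
    also have "\<dots> = fls_const (1 / fact a) * fls_X_inv ^ Suc a * gauss_integral (fps_X ^ a)"
      unfolding qqed_Z_nth_Suc unfolding qqed_Z_nth
      by (simp add: p gauss_integral_diff flip: right_diff_distrib del: power_Suc)
    also have "\<dots> = (?k * qqed_Z $ 0) $ a"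
      by (simp add: qqed_Z_nth divide_inverse fls_inverse_X mult_ac)
    finally show "(qqed_Z $ 1 - ?h * fps_deriv (qqed_Z $ 1)) $ a = (?k * gaussian) $ a"
      by (simp add: qqed_Z_0)
  qed
  have "?h * fps_deriv y = ?k * (?h * fps_deriv gaussian) * free_W1 + ?k * gaussian * (?h * fps_deriv free_W1)"
    unfolding y_def by (simp add: algebra_simps)
  also have "\<dots> = y - ?k * gaussian * ((1 - fps_X) * free_W1 - ?h * fps_deriv free_W1)"
    unfolding gaussian_deriv y_def by (simp add: algebra_simps)
  finally have Y: "y - ?h * fps_deriv y = ?k * gaussian"
    by (simp add: free_W1_ode)
  \<comment> \<open>The inhomogeneities cancel; uniqueness applies once the constant terms
    agree.\<close>
  have "?h * fps_deriv (qqed_Z $ 1 - y) = qqed_Z $ 1 - y"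
    using Y Z by (simp only: fps_deriv_sub right_diff_distrib) algebra
  then have "fps_deriv (qqed_Z $ 1 - y) = ?k * (qqed_Z $ 1 - y)"
    by (rule fps_const_hbar_mult_eqD)
  moreover have "(qqed_Z $ 1 - y) $ 0 = 0"
  proof -
    \<comment> \<open>At j = 0 every even moment enters with coefficient 1, which gives
      \<open>chi\<close>.\<close>
    have "gauss_integral (inverse (1 - fps_X)) = fps_to_fls chi"
      by (simp add: gauss_integral_def chi_def fps_inverse_one_minus_fps_X)
    then show ?thesis
      by (simp add: y_def gaussian_nth_0 free_W1_nth_0 qqed_Z_nth divide_inverse fls_inverse_X)
  qed
  ultimately show ?thesis using fps_linear_ode_zero unfolding y_def by (metis eq_iff_diff_eq_0)
qed

section \<open>First order of the free energy\<close>

lemma fps_nth_1_power: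
  fixes F :: "'a :: comm_ring_1 fps"
  shows "F ^ n $ 1 = of_nat n * (F $ 0) ^ (n - 1) * F $ 1"
proof (induction n)
  case (Suc n)
  have "F ^ Suc n $ 1 = F $ 0 * F ^ n $ 1 + F $ 1 * F ^ n $ 0"
    by (simp add: fps_mult_nth_1)
  also have "F ^ n $ 0 = (F $ 0) ^ n" by (simp add: fps_power_zeroth)
  finally show ?case unfolding Suc by (cases n) (simp_all add: algebra_simps)
qed auto

text \<open>At order 0 in s the cut-off sum is composition with log(1 + X), which undoes the
  exponential.\<close>

lemma bser_log_0:
  assumes "F $ 0 = exp_over_hbar p" "p $ 0 = 0"
  shows "bser_log F $ 0 = fps_const fls_X_inv * p"
proof -
  let ?k = "fls_X_inv :: real fls"
  have E: "F $ 0 - 1 = (fps_exp ?k - 1) oo p"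
    using assms(1) by (simp add: exp_over_hbar_eq fps_compose_sub_distrib)
  have e0: "(fps_exp ?k - 1) $ 0 = 0" "(fps_exp ?k - 1) $ 1 \<noteq> 0" by simp_all
  have "bser_log F $ 0 = fps_ln 1 oo (F $ 0 - 1)"
  proof (rule fps_ext)
    fix a
    have "bser_log F $ 0 $ a = (\<Sum>n=1..a. (- 1) ^ (n + 1) / of_nat n * ((F $ 0 - 1) ^ n $ a))"
      by (simp add: bser_log_def fps_power_zeroth)
    also have "\<dots> = (\<Sum>n=1..a. fps_ln 1 $ n * ((F $ 0 - 1) ^ n $ a))"
      by (intro sum.cong) (auto simp: fps_ln_nth power_Suc2 gr0_conv_Suc Suc_le_eq)
    also have "\<dots> = (\<Sum>n=0..a. fps_ln 1 $ n * ((F $ 0 - 1) ^ n $ a))"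
      by (intro sum.mono_neutral_left) (auto simp: Suc_le_eq)
    finally show "bser_log F $ 0 $ a = (fps_ln 1 oo (F $ 0 - 1)) $ a"
      by (simp add: fps_compose_nth)
  qed
  \<comment> \<open>\<open>fps_ln k\<close> is log(1 + X) / k, and with this scaling it is the
    compositional inverse of \<open>fps_exp k - 1\<close>.\<close>
  also have "fps_ln 1 = fps_const ?k * fps_ln ?k"
  proof -
    have k: "?k * (1 / ?k) = 1" 
      by (simp only: times_divide_eq_right mult_1_right divide_self fls_X_inv_nonzero simp_thms)
    show ?thesis
      by (simp only: fps_ln_def mult.assoc[symmetric] fps_const_mult k div_by_1)
  qed
  also have "(fps_const ?k * fps_ln ?k) oo (F $ 0 - 1) = fps_const ?k * ((fps_ln ?k oo (fps_exp ?k - 1)) oo p)"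
    unfolding E using assms(2) e0(1) by (simp add: fps_const_mult_apply_left fps_compose_assoc)
  also have "fps_ln ?k oo (fps_exp ?k - 1) = fps_X"
    using fps_inv[OF e0] by (simp add: fps_ln_fps_exp_inv)
  finally show ?thesis using assms(2) by simp
qed

text \<open>The coefficient of s in \<open>(F - 1) ^ n\<close> is n (F_0 - 1)^(n-1) F_1, so the sum
  becomes geometric in q = 1 - F_0. The cut-off is exact because q^(a+1) has no term in j^a.\<close>

lemma bser_log_1:
  assumes "F $ 0 $ 0 = 1"
  shows "bser_log F $ 1 = inverse (F $ 0) * F $ 1"
proof -
  define q where "q = 1 - F $ 0"
  have q0: "q $ 0 = 0" using assms by (simp add: q_def)
  have qpow: "q ^ n $ i = 0" if "i < n" for n i
    using that q0 startsby_zero_power_prefix by blast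
  have F: "F $ 0 = 1 - q" by (simp add: q_def)
  have c: "(F - 1) ^ n $ 1 = of_nat n * (F $ 0 - 1) ^ (n - 1) * F $ 1" for n
    using fps_nth_1_power[of "F - 1" n] by simp
  show ?thesis
  proof (rule fps_ext)
    fix a
    have "bser_log F $ 1 $ a = (\<Sum>n=1..1+a. (- 1) ^ (n + 1) / of_nat n * (of_nat n * (F $ 0 - 1) ^ (n - 1) * F $ 1) $ a)"
      by (simp only: bser_log_def fps_nth_Abs_fps c)
    also have "\<dots> = (\<Sum>n=1..1+a. (q ^ (n - 1) * F $ 1) $ a)"
    proof (intro sum.cong refl)
      fix n assume "n \<in> {1..1+a}"
      then obtain m where m: "n = Suc m" by (cases n) auto
      have "F $ 0 - 1 = - q" by (simp add: q_def)
      then have "(F $ 0 - 1) ^ m = (- 1) ^ m * q ^ m" by (metis power_minus)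
      moreover have "((of_nat n :: real fls fps) * G) $ a = of_nat n * G $ a" for G
        by (simp add: fps_of_nat[symmetric] del: fps_of_nat of_nat_Suc)
      moreover have "((- 1) ^ m * (G :: real fls fps)) $ a = (- 1) ^ m * G $ a" for G
        by (cases "even m") auto
      ultimately show "(- 1) ^ (n + 1) / of_nat n * (of_nat n * (F $ 0 - 1) ^ (n - 1) * F $ 1) $ a = (q ^ (n - 1) * F $ 1) $ a"
        by (simp add: m mult.assoc del: of_nat_Suc)
    qed
    also have "\<dots> = (\<Sum>n=0..a. (q ^ n * F $ 1) $ a)"
      by (rule sum.reindex_bij_witness[of _ Suc "\<lambda>n. n - 1"]) auto
    also have "\<dots> = ((\<Sum>n=0..a. q ^ n) * F $ 1) $ a"
      by (simp add: sum_distrib_right fps_sum_nth)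
    also have "\<dots> = (inverse (F $ 0) * F $ 1) $ a"
    proof -
      have inv: "(1 - q) * inverse (1 - q) = 1"
        using q0 by (simp add: inverse_mult_eq_1')
      have "(\<Sum>n=0..a. q ^ n) * (1 - q) = 1 - q ^ Suc a"
        by (metis atLeast0AtMost mult.commute one_diff_power_eq lessThan_Suc_atMost)
      then have "(\<Sum>n=0..a. q ^ n) * ((1 - q) * inverse (1 - q)) = (1 - q ^ Suc a) * inverse (1 - q)"
        by (metis mult.assoc)
      then have "(\<Sum>n=0..a. q ^ n) = (1 - q ^ Suc a) * inverse (1 - q)"
        unfolding inv mult_1_right .
      also have "\<dots> = inverse (1 - q) - q ^ Suc a * inverse (1 - q)"
        by (simp only: left_diff_distrib mult_1)
      finally have "(\<Sum>n=0..a. q ^ n) = inverse (1 - q) - q ^ Suc a * inverse (1 - q)" .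
      then have "(\<Sum>n=0..a. q ^ n) * F $ 1 = inverse (F $ 0) * F $ 1 - q ^ Suc a * (inverse (1 - q) * F $ 1)"
        by (simp add: F left_diff_distrib mult.assoc)
      moreover have "(q ^ Suc a * (inverse (1 - q) * F $ 1)) $ a = 0"
        unfolding fps_mult_nth[of "q ^ Suc a"] by (intro sum.neutral) (auto simp: qpow simp del: power_Suc)
      ultimately show ?thesis by simp
    qed
    finally show "bser_log F $ 1 $ a = (inverse (F $ 0) * F $ 1) $ a" .
  qed
qed

lemma qqed_W_0: "qqed_W $ 0 = rconst (1/2) * fps_X ^ 2"
proof -
  have "bser_log qqed_Z $ 0 = fps_const fls_X_inv * (rconst (1/2) * fps_X ^ 2)"
    by (rule bser_log_0) (simp_all add: qqed_Z_0 gaussian_def)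
  then show ?thesis by (simp add: qqed_W_def fps_const_hbar_cancel)
qed

lemma qqed_W_1: "qqed_W $ 1 = free_W1"
proof -
  have "bser_log qqed_Z $ 1 = inverse gaussian * (fps_const fls_X_inv * gaussian * free_W1)"
    using bser_log_1[of qqed_Z, unfolded qqed_Z_0 qqed_Z_1 gaussian_nth_0] by simp
  also have "\<dots> = fps_const fls_X_inv * free_W1 * (gaussian * inverse gaussian)"
    by (simp only: mult_ac)
  also have "gaussian * inverse gaussian = 1"
    by (simp add: inverse_mult_eq_1' gaussian_nth_0)
  finally show ?thesis by (simp add: qqed_W_def fps_const_hbar_cancel)
qed

section \<open>Legendre transform\<close>

lemma tser_of_nth: "tser_of F $ q $ p = (if p = q then F $ q else 0)"
  by (simp add: tser_of_def)

lemma tser_of_inject: "tser_of F = tser_of G \<longleftrightarrow> F = G"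
proof
  assume "tser_of F = tser_of G"
  then have "tser_of F $ q $ q = tser_of G $ q $ q" for q by simp
  then show "F = G" by (simp add: tser_of_nth fps_eq_iff)
qed simp

lemma tser_of_diff: "tser_of (F - G) = tser_of F - tser_of G"
  by (rule fps_ext, rule fps_ext) (simp add: tser_of_nth)

text \<open>Only the diagonal \<open>j = i\<close> of the double convolution survives. Thus the
  Legendre equation can be pulled back to series in s.\<close>

lemma tser_of_mult: "tser_of (F * G) = tser_of F * tser_of G"
proof (rule fps_ext, rule fps_ext)
  fix q p
  have inner: "(\<Sum>j=0..p. tser_of F $ i $ j * tser_of G $ (q - i) $ (p - j)) =
          (if p = q then F $ i * G $ (q - i) else 0)" if "i \<in> {0..q}" for i
  proof -
    have "(\<Sum>j=0..p. tser_of F $ i $ j * tser_of G $ (q - i) $ (p - j)) =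
          (\<Sum>j=0..p. if j = i then (if p = q then F $ i * G $ (q - i) else 0) else 0)"
      using that by (intro sum.cong refl) (auto simp: tser_of_nth)
    also have "\<dots> = (if p = q then F $ i * G $ (q - i) else 0)"
      using that by (simp add: sum.delta)
    finally show ?thesis .
  qed
  have "(tser_of F * tser_of G) $ q $ p =
          (\<Sum>i=0..q. \<Sum>j=0..p. tser_of F $ i $ j * tser_of G $ (q - i) $ (p - j))"
    by (simp add: fps_mult_nth fps_sum_nth)
  also have "\<dots> = (\<Sum>i=0..q. if p = q then F $ i * G $ (q - i) else 0)"
    by (rule sum.cong[OF refl inner])
  also have "\<dots> = tser_of (F * G) $ q $ p"
    by (simp add: tser_of_nth fps_mult_nth)
  finally show "tser_of (F * G) $ q $ p = (tser_of F * tser_of G) $ q $ p" ..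
qed

lemma tser_of_1: "tser_of 1 = 1"
  by (rule fps_ext, rule fps_ext) (simp add: tser_of_nth)

lemma tser_of_power: "tser_of (F ^ n) = tser_of F ^ n"
  by (induction n) (simp_all add: tser_of_1 tser_of_mult)

definition bser_deriv_j :: "bser \<Rightarrow> bser"
  where "bser_deriv_j F = Abs_fps (\<lambda>m. fps_deriv (F $ m))"

lemma deriv_j_tser_of: "deriv_j (tser_of F) = tser_of (bser_deriv_j F)"
  by (rule fps_ext, rule fps_ext) (simp add: tser_of_nth deriv_j_def bser_deriv_j_def)

lemma deriv_etabar_tser_of: "deriv_etabar (tser_of F) = var_eta * tser_of (fps_deriv F)"
proof (rule fps_ext, rule fps_ext)
  fix q p
  have "deriv_etabar (tser_of F) $ q $ p = (of_nat (q + 1) * tser_of F $ (q + 1)) $ p"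
    by (simp add: deriv_etabar_def)
  also have "\<dots> = of_nat (q + 1) * tser_of F $ (q + 1) $ p"
    by (simp add: fps_of_nat[symmetric] del: fps_of_nat of_nat_Suc of_nat_add)
  also have "\<dots> = (var_eta * tser_of (fps_deriv F)) $ q $ p"
    by (auto simp: var_eta_def tser_of_nth)
  finally show "deriv_etabar (tser_of F) $ q $ p = (var_eta * tser_of (fps_deriv F)) $ q $ p" .
qed

lemma deriv_eta_tser_of: "deriv_eta (tser_of F) = var_etabar * tser_of (fps_deriv F)"
  by (rule fps_ext, rule fps_ext) (auto simp: deriv_eta_def var_etabar_def tser_of_nth)

lemma var_eta_mult_var_etabar: "var_eta * var_etabar = tser_of fps_X"
  by (rule fps_ext, rule fps_ext) (auto simp: var_eta_def var_etabar_def tser_of_nth)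

lemma var_j_eq_tser_of: "var_j = tser_of (fps_const fps_X)"
  by (rule fps_ext, rule fps_ext) (auto simp: var_j_def tser_of_nth)

text \<open>\<open>|\<psi>\<^sub>c|\<^sup>2\<close> as a series in \<open>j\<close> and \<open>|\<eta>|\<^sup>2\<close>\<close>
definition psi_squared :: "bser \<Rightarrow> bser"
  where "psi_squared W = fps_X * fps_deriv W ^ 2"

text \<open>Both etabar psi_c and its conjugate equal s dW/ds, hence the repeated term.\<close>

definition legendre_rhs :: "bser \<Rightarrow> bser"
  where "legendre_rhs W = W - fps_const fps_X * bser_deriv_j W - fps_X * fps_deriv W - fps_X * fps_deriv W"

text \<open>The contribution of \<open>g(\<phi>\<^sub>c) |\<psi>\<^sub>c|\<^sup>2\<^sup>m\<close> to order \<open>q\<close> in \<open>|\<eta>|\<^sup>2\<close>\<close>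
definition legendre_term :: "bser \<Rightarrow> nat \<Rightarrow> real fls fps \<Rightarrow> nat \<Rightarrow> real fls fps"
  where "legendre_term W m g q = Abs_fps (\<lambda>l.
           \<Sum>a\<le>2 * q + l. g $ a * (bser_deriv_j W ^ a * psi_squared W ^ m) $ q $ l)"

lemma psi_squared_power: "psi_squared W ^ m = fps_X ^ m * fps_deriv W ^ (2 * m)"
  by (simp add: psi_squared_def power_mult_distrib power_mult)

text \<open>Divisibility of |psi_c|^2 by s makes the Legendre equation triangular.\<close>

lemma legendre_monomial_nth_less:
  "q < m \<Longrightarrow> (F * psi_squared W ^ m) $ q = 0"
  unfolding psi_squared_power mult.left_commute[of F] by (simp add: fps_X_power_mult_nth)

lemma legendre_monomial_nth_diag:
  assumes "fps_deriv (W $ 0) = fps_X"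
  shows "(bser_deriv_j W ^ a * psi_squared W ^ m) $ m = fps_X ^ a * (W $ 1) ^ (2 * m)"
  unfolding psi_squared_power mult.left_commute[of _ "fps_X ^ m"]
  by (simp add: fps_X_power_mult_nth fps_power_zeroth bser_deriv_j_def assms)

text \<open>The factor s^q is used up by |psi_c|^2, so phi_c enters only through its order 0, which
  is j, and substitution becomes multiplication. Powers \<open>a\<close> above \<open>l\<close> do
  not reach the coefficient of j^l.\<close>

lemma legendre_term_diag:
  assumes "fps_deriv (W $ 0) = fps_X"
  shows "legendre_term W q g q = g * (W $ 1) ^ (2 * q)"
proof (rule fps_ext)
  fix l
  let ?v = "(W $ 1) ^ (2 * q)"
  have "legendre_term W q g q $ l = (\<Sum>a\<le>2 * q + l. g $ a * (fps_X ^ a * ?v) $ l)"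
    by (simp add: legendre_term_def legendre_monomial_nth_diag[OF assms])
  also have "\<dots> = (\<Sum>a\<in>{0..l}. g $ a * (fps_X ^ a * ?v) $ l)"
    by (intro sum.mono_neutral_right) (auto simp: fps_X_power_mult_nth)
  also have "\<dots> = (g * ?v) $ l"
    unfolding fps_mult_nth[of g] by (intro sum.cong) (auto simp: fps_X_power_mult_nth)
  finally show "legendre_term W q g q $ l = (g * ?v) $ l" .
qed

text \<open>On the diagonal \<open>p = q\<close> the cut-off is \<open>2 * q + l\<close>; orders
  above \<open>q\<close> vanish and order \<open>q\<close> is the diagonal entry.\<close>

lemma tser_subst_tser_of:
  assumes "fps_deriv (W $ 0) = fps_X"
  shows "tser_subst G (tser_of (bser_deriv_j W)) (tser_of (psi_squared W)) =
    tser_of (Abs_fps (\<lambda>q. (\<Sum>m<q. legendre_term W m (G $ m) q) + G $ q * (W $ 1) ^ (2 * q)))"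
proof (rule fps_ext, rule fps_ext, rule fps_ext)
  fix q p l
  let ?M = "\<lambda>a m. bser_deriv_j W ^ a * psi_squared W ^ m"
  have "tser_subst G (tser_of (bser_deriv_j W)) (tser_of (psi_squared W)) $ q $ p $ l =
     (\<Sum>m\<le>q + p + l. \<Sum>a\<le>q + p + l. G $ m $ a * (tser_of (?M a m) $ q $ p $ l))"
    by (simp add: tser_subst_def tser_of_mult tser_of_power)
  also have "\<dots> = (if p = q then \<Sum>m\<le>2 * q + l. legendre_term W m (G $ m) q $ l else 0)"
    by (simp add: tser_of_nth legendre_term_def mult_2)
  also have "(\<Sum>m\<le>2 * q + l. legendre_term W m (G $ m) q $ l) = (\<Sum>m\<le>q. legendre_term W m (G $ m) q $ l)"
    by (intro sum.mono_neutral_right) (auto simp: legendre_term_def legendre_monomial_nth_less)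
  also have "\<dots> = ((\<Sum>m<q. legendre_term W m (G $ m) q) + G $ q * (W $ 1) ^ (2 * q)) $ l"
    by (simp add: fps_sum_nth legendre_term_diag[OF assms] flip: lessThan_Suc_atMost)
  finally show "tser_subst G (tser_of (bser_deriv_j W)) (tser_of (psi_squared W)) $ q $ p $ l =
    tser_of (Abs_fps (\<lambda>q. (\<Sum>m<q. legendre_term W m (G $ m) q) + G $ q * (W $ 1) ^ (2 * q))) $ q $ p $ l"
    by (simp add: tser_of_nth)
qed

text \<open>The diagonal entry is a power of the unit \<open>W $ 1\<close> and can be divided
  out.\<close>

lemma is_legendre_transform_iff:
  assumes "fps_deriv (W $ 0) = fps_X" "W $ 1 $ 0 \<noteq> 0"
  shows "is_legendre_transform W G \<longleftrightarrow>
    (\<forall>q. G $ q = (legendre_rhs W $ q - (\<Sum>m<q. legendre_term W m (G $ m) q)) * inverse (W $ 1) ^ (2 * q))"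
proof -
  have psi: "deriv_etabar (tser_of W) * deriv_eta (tser_of W) = tser_of (psi_squared W)"
  proof -
    have "deriv_etabar (tser_of W) * deriv_eta (tser_of W) =
            (var_eta * var_etabar) * (tser_of (fps_deriv W) * tser_of (fps_deriv W))"
      unfolding deriv_eta_tser_of deriv_etabar_tser_of by (simp only: mult_ac)
    also have "\<dots> = tser_of (psi_squared W)"
      unfolding var_eta_mult_var_etabar psi_squared_def power2_eq_square by (simp only: tser_of_mult)
    finally show ?thesis .
  qed
  have rhs: "tser_of W - var_j * tser_of (bser_deriv_j W) - var_etabar * deriv_etabar (tser_of W)
        - var_eta * deriv_eta (tser_of W) = tser_of (legendre_rhs W)"
    unfolding deriv_eta_tser_of deriv_etabar_tser_of legendre_rhs_def tser_of_diff tser_of_mult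
      var_j_eq_tser_of var_eta_mult_var_etabar[symmetric]
    by (simp only: mult_ac)
  let ?v = "W $ 1"
  have inv: "?v ^ n * inverse ?v ^ n = 1" for n
    using assms(2) by (simp add: inverse_mult_eq_1' flip: power_mult_distrib)
  have solve: "S + x * ?v ^ n = H \<longleftrightarrow> x = (H - S) * inverse ?v ^ n" for S x H n
  proof
    assume "S + x * ?v ^ n = H"
    then have "H - S = x * ?v ^ n" by (simp add: algebra_simps)
    then have "(H - S) * inverse ?v ^ n = x * (?v ^ n * inverse ?v ^ n)" by (simp only: mult.assoc)
    then show "x = (H - S) * inverse ?v ^ n" unfolding inv by simp
  next
    assume "x = (H - S) * inverse ?v ^ n"
    then have "x * ?v ^ n = (H - S) * (?v ^ n * inverse ?v ^ n)" by (simp only: mult_ac)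
    then show "S + x * ?v ^ n = H" unfolding inv by simp
  qed
  show ?thesis
    unfolding is_legendre_transform_def Let_def psi deriv_j_tser_of rhs tser_subst_tser_of[OF assms(1)] tser_of_inject
    by (simp only: fps_eq_iff[where 'a = "real fls fps"] fps_nth_Abs_fps solve)
qed

text \<open>Strong recursion, since \<open>G $ q\<close> depends on all \<open>G $ m\<close> with
  \<open>m < q\<close>; the guard secures termination.\<close>

fun course_of_values :: "(nat \<Rightarrow> (nat \<Rightarrow> 'a) \<Rightarrow> 'a) \<Rightarrow> nat \<Rightarrow> 'a"
  where "course_of_values \<Phi> n = \<Phi> n (\<lambda>m. if m < n then course_of_values \<Phi> m else undefined)"

declare course_of_values.simps [simp del]

text \<open>Justifies the definite description in \<open>qqed_G\<close>.\<close>

lemma is_legendre_transform_ex1: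
  assumes "fps_deriv (W $ 0) = fps_X" "W $ 1 $ 0 \<noteq> 0"
  shows "\<exists>!G. is_legendre_transform W G"
proof -
  define \<Phi> where "\<Phi> q G = (legendre_rhs W $ q - (\<Sum>m<q. legendre_term W m (G m) q)) * inverse (W $ 1) ^ (2 * q)"
    for q and G :: "nat \<Rightarrow> real fls fps"
  have \<Phi>_cong: "\<Phi> q G = \<Phi> q G'" if "\<And>m. m < q \<Longrightarrow> G m = G' m" for q G G'
    using that by (simp add: \<Phi>_def)
  have iff: "is_legendre_transform W G \<longleftrightarrow> (\<forall>q. G $ q = \<Phi> q (fps_nth G))" for G
    unfolding is_legendre_transform_iff[OF assms] \<Phi>_def ..
  show ?thesis
  proof
    show "is_legendre_transform W (Abs_fps (course_of_values \<Phi>))"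
      unfolding iff by (auto simp: course_of_values.simps[of \<Phi>] intro!: \<Phi>_cong)
  next
    fix G assume "is_legendre_transform W G"
    then have G: "G $ q = \<Phi> q (fps_nth G)" for q unfolding iff by blast
    have "G $ q = course_of_values \<Phi> q" for q
    proof (induction q rule: less_induct)
      case (less q)
      then show ?case
        unfolding G[of q] course_of_values.simps[of \<Phi> q] by (auto intro!: \<Phi>_cong)
    qed
    then show "G = Abs_fps (course_of_values \<Phi>)" by (simp add: fps_eq_iff)
  qed
qed

text \<open>Order 0 reads j^2/2 - j * j. At order 1 the right side is - j V' - V with V =
  \<open>W $ 1\<close>, and - phi_c^2 / 2 contributes - j V', so that G_1 V^2 = - V remains.\<close>

lemma legendre_transform_low_order:
  assumes W0: "W $ 0 = rconst (1/2) * fps_X ^ 2" and W1: "W $ 1 $ 0 \<noteq> 0"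
    and G: "is_legendre_transform W G"
  shows "G $ 0 = - rconst (1/2) * fps_X ^ 2" "G $ 1 = - inverse (W $ 1)"
proof -
  let ?c = "rconst (1/2)" and ?v = "W $ 1"
  have half: "?c * x + ?c * x = x" for x
    using half_plus_half by (metis distrib_right mult_1)
  have dW0: "fps_deriv (W $ 0) = fps_X"
  proof -
    have "fps_deriv (W $ 0) = ?c * fps_X + ?c * fps_X"
      unfolding W0 by (simp add: power2_eq_square rconst_def algebra_simps)
    then show ?thesis by (simp only: half)
  qed
  note iff = is_legendre_transform_iff[OF dW0 W1]
  have "G $ 0 = legendre_rhs W $ 0" using G[unfolded iff, rule_format, of 0] by simp
  also have "\<dots> = ?c * fps_X ^ 2 - fps_X ^ 2"
    by (simp add: legendre_rhs_def bser_deriv_j_def dW0 power2_eq_square) (simp add: W0 power2_eq_square)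
  also have "\<dots> = ?c * fps_X ^ 2 - (?c * fps_X ^ 2 + ?c * fps_X ^ 2)" by (simp only: half)
  finally show G0: "G $ 0 = - ?c * fps_X ^ 2" by simp
  have order1: "legendre_term W 0 (G $ 0) 1 = - (fps_X * fps_deriv ?v)"
  proof (rule fps_ext)
    fix l
    have G0nth: "G $ 0 $ a = (if a = 2 then - fls_const (1/2) else 0)" for a
      by (auto simp: G0 rconst_def fps_X_power_nth)
    have "legendre_term W 0 (G $ 0) 1 $ l = (\<Sum>a\<le>2 * 1 + l. if a = 2 then - fls_const (1/2) * (bser_deriv_j W ^ 2) $ 1 $ l else 0)"
      unfolding legendre_term_def fps_nth_Abs_fps by (rule sum.cong) (simp_all add: G0nth)
    also have "\<dots> = (- ?c * (bser_deriv_j W ^ 2) $ 1) $ l"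
      by (simp add: rconst_def)
    \<comment> \<open>The square of phi_c = j + s V' + O(s^2) has coefficient 2 j V' at order
      1.\<close>
    also have "(bser_deriv_j W ^ 2) $ 1 = fps_X * fps_deriv ?v + fps_X * fps_deriv ?v"
      by (simp add: power2_eq_square fps_mult_nth_1 bser_deriv_j_def dW0 mult.commute)
    also have "- ?c * (fps_X * fps_deriv ?v + fps_X * fps_deriv ?v) = - (?c * (fps_X * fps_deriv ?v) + ?c * (fps_X * fps_deriv ?v))"
      by (simp add: algebra_simps)
    finally show "legendre_term W 0 (G $ 0) 1 $ l = (- (fps_X * fps_deriv ?v)) $ l" by (simp only: half)
  qed
  have "legendre_rhs W $ 1 = - fps_X * fps_deriv ?v - ?v"
    by (simp add: legendre_rhs_def bser_deriv_j_def)
  then have "G $ 1 = - ?v * inverse ?v ^ 2"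
    using G[unfolded iff, rule_format, of 1] order1 by simp
  also have "\<dots> = - (?v * inverse ?v) * inverse ?v" by (simp add: power2_eq_square)
  also have "?v * inverse ?v = 1" using W1 by (simp add: inverse_mult_eq_1')
  finally show "G $ 1 = - inverse ?v" by simp
qed

lemma free_W1_nth_0_nonzero: "free_W1 $ 0 \<noteq> 0"
proof -
  have "chi $ 0 \<noteq> 0" by (simp add: chi_def)
  then have "chi \<noteq> 0" by fastforce
  then show ?thesis by (simp add: free_W1_nth_0)
qed

lemma qqed_G_low_order:
  "qqed_G $ 0 = - rconst (1/2) * fps_X ^ 2" "qqed_G $ 1 = - inverse free_W1"
proof -
  have d: "fps_deriv (qqed_W $ 0) = fps_X"
  proof -
    have "fps_deriv (qqed_W $ 0) = (rconst (1/2) + rconst (1/2)) * fps_X"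
      unfolding qqed_W_0 by (simp add: power2_eq_square rconst_def algebra_simps)
    then show ?thesis by (simp add: half_plus_half)
  qed
  have nz: "qqed_W $ 1 $ 0 \<noteq> 0" unfolding qqed_W_1 by (rule free_W1_nth_0_nonzero)
  have "is_legendre_transform qqed_W qqed_G"
    unfolding qqed_G_def by (rule theI'[OF is_legendre_transform_ex1[OF d nz]])
  from legendre_transform_low_order[OF qqed_W_0 nz this, unfolded qqed_W_1]
  show "qqed_G $ 0 = - rconst (1/2) * fps_X ^ 2" "qqed_G $ 1 = - inverse free_W1" .
qed

section \<open>Asymptotic expansions of the coefficients\<close>

definition coeff_asymp :: "real fls fps \<Rightarrow> real fls fps \<Rightarrow> bool"
  where "coeff_asymp F T \<longleftrightarrow> (\<forall>l. laurent_asymp (F $ l) (T $ l))"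

lemma coeff_asymp_mult:
  assumes "coeff_asymp F T" "coeff_asymp F' T'"
  shows "coeff_asymp (F * F') (F * T' + F' * T)"
proof -
  have "laurent_asymp (\<Sum>i=0..l. F $ i * F' $ (l - i)) (\<Sum>i=0..l. F $ i * T' $ (l - i) + F' $ (l - i) * T $ i)" for l
    using assms by (intro laurent_asymp_sum laurent_asymp_mult) (auto simp: coeff_asymp_def)
  moreover have "(F * T' + F' * T) $ l = (\<Sum>i=0..l. F $ i * T' $ (l - i) + F' $ (l - i) * T $ i)" for l
    unfolding mult.commute[of F' T]
    by (simp add: fps_mult_nth sum.distrib) (simp only: mult.commute)
  ultimately show ?thesis by (simp add: coeff_asymp_def fps_mult_nth)
qed

text \<open>Only inversion of the constant coefficient needs estimates. The higher coefficients
  follow recursively from \<open>F * U = 1\<close> and its derived form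
  \<open>F * S + T * U = 0\<close> by ring operations.\<close>

lemma coeff_asymp_inverse:
  assumes FT: "coeff_asymp F T" and F0: "F $ 0 \<noteq> 0"
    and inv0: "laurent_asymp (inverse (F $ 0)) (- T $ 0 * inverse (F $ 0) ^ 2)"
  shows "coeff_asymp (inverse F) (- T * inverse F ^ 2)"
proof -
  define U where "U = inverse F"
  define S where "S = - T * U ^ 2"
  have FU: "F * U = 1" unfolding U_def using F0 by (simp add: inverse_mult_eq_1')
  have FS: "F * S + T * U = 0"
  proof -
    have "F * S + T * U = - T * U * (F * U) + T * U" unfolding S_def by (simp add: power2_eq_square)
    then show ?thesis by (simp add: FU)
  qed
  have U0: "U $ 0 = inverse (F $ 0)" by (simp add: U_def)
  have S0: "S $ 0 = - T $ 0 * U $ 0 * U $ 0" by (simp add: S_def fps_power_zeroth power2_eq_square)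
  have "laurent_asymp (U $ l) (S $ l)" for l
  proof (induction l rule: less_induct)
    case (less l)
    show ?case
    proof (cases "l = 0")
      case True
      then show ?thesis using inv0 by (simp add: U0 S0 power2_eq_square mult_ac)
    next
      case False
      define A where "A = (\<Sum>i=1..l. F $ i * U $ (l - i))"
      define B where "B = (\<Sum>i=1..l. F $ i * S $ (l - i) + U $ (l - i) * T $ i)"
      have AB: "laurent_asymp A B"
        unfolding A_def B_def using FT less by (intro laurent_asymp_sum laurent_asymp_mult) (auto simp: coeff_asymp_def)
      have head: "(P * Q) $ l = P $ 0 * Q $ l + (\<Sum>i=1..l. P $ i * Q $ (l - i))" for P Q :: "real fls fps"
        unfolding fps_mult_nth by (simp add: sum.atLeast_Suc_atMost)
      have "F $ 0 * U $ l + A = 0"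
        using head[of F U] False by (simp add: FU A_def)
      then have "U $ 0 * (F $ 0 * U $ l + A) = 0" by simp
      then have Ul: "U $ l = - (U $ 0 * A)"
        using F0 by (simp add: distrib_left U0 eq_neg_iff_add_eq_0 flip: mult.assoc)
      have "F $ 0 * S $ l + T $ 0 * U $ l + B = (F * S + T * U) $ l"
        unfolding fps_add_nth head B_def by (simp add: sum.distrib mult.commute)
      then have "U $ 0 * (F $ 0 * S $ l + T $ 0 * U $ l + B) = 0" by (simp add: FS)
      then have "S $ l + U $ 0 * (T $ 0 * U $ l) + U $ 0 * B = 0"
        using F0 by (simp add: distrib_left U0 mult.assoc[symmetric, of _ "F $ 0"])
      \<comment> \<open>This is the product rule applied to the formula for
        \<open>U $ l\<close>.\<close>
      then have Sl: "S $ l = - (U $ 0 * B + A * S $ 0)"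
        unfolding Ul S0 by (simp add: eq_neg_iff_add_eq_0 algebra_simps)
      have "laurent_asymp (U $ 0) (S $ 0)" using less[of 0] False by simp
      from laurent_asymp_minus[OF laurent_asymp_mult[OF this AB]]
      show ?thesis unfolding Ul Sl .
    qed
  qed
  then show ?thesis by (simp add: coeff_asymp_def U_def S_def)
qed

text \<open>Turns an equation in j into a recursion by monomials in 1/hbar, and multiplication by
  these preserves \<open>laurent_asymp\<close>.\<close>

lemma hbar_deriv_nth:
  assumes "fps_const hbar * fps_deriv y = z"
  shows "y $ Suc l = fls_const (1 / real (Suc l)) * fls_X_inv ^ 1 * z $ l"
proof -
  have c: "fls_const (1 / real (Suc l)) * of_nat (Suc l) = 1"
    by (simp add: fls_of_nat fls_const_mult_const del: of_nat_Suc)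
  have "fls_const (1 / real (Suc l)) * fls_X_inv ^ 1 * z $ l =
     (fls_const (1 / real (Suc l)) * of_nat (Suc l)) * (fls_X_inv * hbar) * y $ Suc l"
    unfolding assms[symmetric] by (simp add: mult_ac del: of_nat_Suc)
  then show ?thesis unfolding c by simp
qed

lemma coeff_asymp_gaussian: "coeff_asymp gaussian 0"
proof -
  have "laurent_asymp (gaussian $ l) 0" for l
  proof (induction l rule: less_induct)
    case (less l)
    show ?case
    proof (cases l)
      case 0
      then show ?thesis using laurent_asymp_monomial[of 1 0] by (simp add: gaussian_nth_0)
    next
      case (Suc m)
      have "laurent_asymp ((fps_X * gaussian) $ m) 0"
        using less[of "m - 1"] Suc by (auto simp: laurent_asymp_0)
      from laurent_asymp_monomial_mult[OF this, of "1 / real (Suc m)" 1] show ?thesis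
        unfolding Suc hbar_deriv_nth[OF gaussian_deriv] by simp
    qed
  qed
  then show ?thesis by (simp add: coeff_asymp_def)
qed

text \<open>The asymptotic expansion of \<open>free_W1\<close>, up to the factor \<open>(2 \<pi> \<hbar>)\<^sup>-\<^sup>1\<^sup>/\<^sup>2\<close>\<close>
definition saddle :: "real fls fps"
  where "saddle = exp_over_hbar (fps_X - rconst (1/2) * fps_X ^ 2)"

lemma saddle_ode: "fps_const hbar * fps_deriv saddle = (1 - fps_X) * saddle"
proof -
  have "fps_deriv (fps_X - rconst (1/2) * fps_X ^ 2) = 1 - (rconst (1/2) + rconst (1/2)) * fps_X"
    by (simp add: power2_eq_square rconst_def algebra_simps)
  then have "fps_deriv (fps_X - rconst (1/2) * fps_X ^ 2) = (1 - fps_X :: real fls fps)"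
    by (simp add: half_plus_half)
  then show ?thesis
    by (simp add: saddle_def fps_deriv_exp_over_hbar fps_const_hbar_cancel mult.assoc)
qed

lemma gaussian_times_saddle: "gaussian * saddle = exp_over_hbar fps_X"
  unfolding gaussian_def saddle_def by (subst exp_over_hbar_add[symmetric]) simp_all

lemma fact_asymp_chi: "fact_asymp R chi 1"
proof -
  \<comment> \<open>At order \<open>R + 1\<close> the term \<open>k = 0\<close> is present and
    cancels \<open>chi\<close> exactly, whereas the sum at order 0 is empty.\<close>
  have "(\<lambda>n. chi $ n - (\<Sum>k<Suc R. 1 $ k * odd_dfact (n - k))) \<in> O(\<lambda>n. odd_dfact (n - Suc R))"
    unfolding sum.lessThan_Suc_shift by (simp add: chi_def)
  then have "fact_asymp (Suc R) chi 1" unfolding fact_asymp_def .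
  then show ?thesis by (rule fact_asymp_mono) simp
qed

text \<open>Both series obey the same recursion in j up to the inhomogeneity 1, whose asymptotic
  expansion is zero; the start at j = 0 is the expansion of \<open>chi\<close>.\<close>

lemma coeff_asymp_free_W1: "coeff_asymp free_W1 saddle"
proof -
  have V: "fps_const hbar * fps_deriv free_W1 = (1 - fps_X) * free_W1 - 1"
    using free_W1_ode by (simp add: algebra_simps)
  have "laurent_asymp (free_W1 $ l) (saddle $ l)" for l
  proof (induction l rule: less_induct)
    case (less l)
    show ?case
    proof (cases l)
      case 0
      have "laurent_asymp (fps_to_fls chi) 1"
        unfolding laurent_asymp_def using fact_asymp_chi
        by (intro exI[of _ 0] exI[of _ chi] exI[of _ "1 :: real fps"]) simp
      then show ?thesis using 0 by (simp add: free_W1_nth_0 saddle_def exp_over_hbar_nth_0)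
    next
      case (Suc m)
      have 1: "laurent_asymp (- (fps_X * free_W1) $ m) (- (fps_X * saddle) $ m)"
        using less[of "m - 1"] Suc by (auto simp: laurent_asymp_0 intro: laurent_asymp_minus)
      have 2: "laurent_asymp (- ((1 :: real fls fps) $ m)) (- 0)"
        by (rule laurent_asymp_minus)
           (use laurent_asymp_monomial[of 1 0] laurent_asymp_0 in \<open>cases m; simp\<close>)
      have "laurent_asymp (free_W1 $ m + - (fps_X * free_W1) $ m + - (1 $ m)) (saddle $ m + - (fps_X * saddle) $ m + - 0)"
        using less[of m] Suc by (intro laurent_asymp_add 1 2) auto
      moreover have "free_W1 $ m + - (fps_X * free_W1) $ m + - (1 $ m) = ((1 - fps_X) * free_W1 - 1) $ m"
        by (simp only: left_diff_distrib fps_sub_nth mult_1 fps_neg_nth add_uminus_conv_diff)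
      moreover have "saddle $ m + - (fps_X * saddle) $ m + - 0 = ((1 - fps_X) * saddle) $ m"
        by (simp only: left_diff_distrib fps_sub_nth mult_1 fps_neg_nth add_uminus_conv_diff minus_zero add_0_right)
      ultimately have "laurent_asymp (((1 - fps_X) * free_W1 - 1) $ m) (((1 - fps_X) * saddle) $ m)"
        by simp
      from laurent_asymp_monomial_mult[OF this, of "1 / real (Suc m)" 1] show ?thesis
        unfolding Suc hbar_deriv_nth[OF V] hbar_deriv_nth[OF saddle_ode] .
    qed
  qed
  then show ?thesis by (simp add: coeff_asymp_def)
qed

lemma coeff_asymp_inverse_free_W1: "coeff_asymp (inverse free_W1) (- saddle * inverse free_W1 ^ 2)"
proof (rule coeff_asymp_inverse[OF coeff_asymp_free_W1 free_W1_nth_0_nonzero])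
  have chi0: "chi $ 0 = 1" by (simp add: chi_def)
  have "subdegree chi = 0" using chi0 by (simp add: subdegree_eq_0_iff)
  then have inv: "inverse (free_W1 $ 0) = fps_to_fls (inverse chi)"
    by (simp add: free_W1_nth_0 fls_inverse_fps_to_fls)
  \<comment> \<open>The analytic input at j = 0: inversion of the power series
    \<open>chi\<close>.\<close>
  have "laurent_asymp (fps_to_fls (inverse chi)) (fps_to_fls (- 1 * inverse chi ^ 2))"
    unfolding laurent_asymp_def
    using fact_asymp_inverse[OF chi0 fact_asymp_chi]
    by (intro exI[of _ 0] exI[of _ "inverse chi"] exI[of _ "- 1 * inverse chi ^ 2 :: real fps"]) simp
  moreover have "fps_to_fls (- 1 * inverse chi ^ 2) = - saddle $ 0 * inverse (free_W1 $ 0) ^ 2"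
    unfolding inv by (simp add: saddle_def exp_over_hbar_nth_0 fps_to_fls_power)
  ultimately show "laurent_asymp (inverse (free_W1 $ 0)) (- saddle $ 0 * inverse (free_W1 $ 0) ^ 2)"
    unfolding inv by simp
qed

section \<open>Orders 0 and 1 combined\<close>

lemma fps_X_power2_dvdI:
  fixes F :: "'a :: comm_ring_1 fps"
  assumes "F $ 0 = 0" "F $ 1 = 0"
  shows "fps_X ^ 2 dvd F"
proof -
  have "F $ n = 0" if "n < 2" for n using that assms by (auto simp: less_2_cases_iff)
  then have "F = fps_X ^ 2 * fps_shift 2 F"
    by (intro fps_ext) (simp add: fps_X_power_mult_nth del: add_2_eq_Suc')
  then show ?thesis by (metis dvd_triv_left)
qed

text \<open>The pole factor of the expansion is moved into \<alpha>, next to the -1/2 from the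
  normalisation; a vanishing expansion fits any exponent.\<close>

lemma has_asymptotics_upto_2I:
  assumes "coeff_asymp (F $ 0) 0" "coeff_asymp (F $ 1) (fps_const (fls_X_inv ^ N) * T)"
    and "\<alpha> = - 1/2 - real N"
  shows "has_asymptotics_upto 2 (1/2) F \<alpha> (fps_X * fps_const (rconst (1 / sqrt (2 * pi)) * T))"
proof -
  have "has_factorial_asymptotics (1/2) (F $ m $ a)
          (hbar_powr_times \<alpha> ((fps_X * fps_const (rconst (1 / sqrt (2 * pi)) * T)) $ m $ a))" if "m < 2" for m a
  proof (cases "m = 0")
    case True
    have zero: "hbar_powr_times \<gamma> 0 = (\<lambda>_. 0)" for \<gamma> by (auto simp: hbar_powr_times_def)
    have "has_factorial_asymptotics (1/2) (F $ 0 $ a) (hbar_powr_times (- 1/2) (fls_const (1 / sqrt (2 * pi)) * 0))"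
      using assms(1) by (intro laurent_asymp_imp_has_factorial_asymptotics) (simp add: coeff_asymp_def)
    with True show ?thesis by (simp add: zero)
  next
    case False
    then have m: "m = 1" using that by simp
    have "laurent_asymp (F $ 1 $ a) (fls_X_inv ^ N * T $ a)"
      using assms(2) by (simp add: coeff_asymp_def)
    then have "has_factorial_asymptotics (1/2) (F $ 1 $ a)
        (hbar_powr_times (- 1/2) (fls_const (1 / sqrt (2 * pi)) * (fls_X_inv ^ N * T $ a)))"
      by (rule laurent_asymp_imp_has_factorial_asymptotics)
    also have "fls_const (1 / sqrt (2 * pi)) * (fls_X_inv ^ N * T $ a) =
        fls_X_inv ^ N * (fps_X * fps_const (rconst (1 / sqrt (2 * pi)) * T)) $ 1 $ a"
      by (simp add: rconst_def mult_ac)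
    finally show ?thesis unfolding m assms(3) hbar_powr_times_shift .
  qed
  then show ?thesis unfolding has_asymptotics_upto_def by blast
qed

lemma coeff_asymp_0I: "(\<And>l. laurent_asymp (F $ l) 0) \<Longrightarrow> coeff_asymp F 0"
  by (simp add: coeff_asymp_def)

lemma coeff_asymp_const_mult_X_square: "coeff_asymp (fps_const (fls_const c) * fps_X ^ 2) 0"
  using laurent_asymp_monomial[of _ 0] by (intro coeff_asymp_0I) (simp add: fps_X_power_nth laurent_asymp_0)

lemma chi_resc_nth_0: "chi_resc $ 0 \<noteq> 0"
proof -
  have "chi_resc $ 0 = free_W1 $ 0" by (simp flip: free_W1_times)
  then show ?thesis using free_W1_nth_0_nonzero by simp
qed

lemma inverse_free_W1: "inverse free_W1 = (1 - fps_X) / chi_resc"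
  using chi_resc_nth_0
  by (simp add: free_W1_def fps_divide_unit fps_inverse_mult mult.commute)

theorem mainTheorem12:
  shows
    "fps_X ^ 2 dvd (qqed_Z
       - fps_const (exp_over_hbar (rconst (1/2) * fps_X ^ 2))
         * (1 + fps_X * fps_const (chi_resc / (fps_const hbar * (1 - fps_X)))))
     \<and> fps_X ^ 2 dvd (qqed_W
       - (fps_const (rconst (1/2) * fps_X ^ 2)
          + fps_X * fps_const (chi_resc / (1 - fps_X))))
     \<and> fps_X ^ 2 dvd (qqed_G
       - (fps_const (- rconst (1/2) * fps_X ^ 2)
          + fps_X * fps_const ((fps_X - 1) / chi_resc)))
     \<and> has_asymptotics_upto 2 (1/2) qqed_Z (- 3/2)
         (fps_X * fps_const (rconst (1 / sqrt (2 * pi)) * exp_over_hbar fps_X))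
     \<and> has_asymptotics_upto 2 (1/2) qqed_W (- 1/2)
         (fps_X * fps_const (rconst (1 / sqrt (2 * pi))
            * exp_over_hbar (fps_X - rconst (1/2) * fps_X ^ 2)))
     \<and> has_asymptotics_upto 2 (1/2) qqed_G (- 1/2)
         (fps_X * fps_const (rconst (1 / sqrt (2 * pi))
            * exp_over_hbar (fps_X - rconst (1/2) * fps_X ^ 2)
            * ((1 - fps_X) ^ 2 / chi_resc ^ 2)))"
proof (intro conjI)
  show "fps_X ^ 2 dvd (qqed_Z
       - fps_const (exp_over_hbar (rconst (1/2) * fps_X ^ 2))
         * (1 + fps_X * fps_const (chi_resc / (fps_const hbar * (1 - fps_X)))))"
  proof (rule fps_X_power2_dvdI)
    have "chi_resc / (fps_const hbar * (1 - fps_X)) = fps_const fls_X_inv * free_W1"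
      by (simp add: free_W1_def fps_divide_unit fps_inverse_mult fps_const_inverse fls_inverse_X mult_ac)
    then show "(qqed_Z - fps_const (exp_over_hbar (rconst (1/2) * fps_X ^ 2))
         * (1 + fps_X * fps_const (chi_resc / (fps_const hbar * (1 - fps_X))))) $ 1 = 0"
      unfolding gaussian_def[symmetric] using qqed_Z_1 by (simp add: mult_ac)
  qed (simp add: qqed_Z_0 gaussian_def)
  show "fps_X ^ 2 dvd (qqed_W - (fps_const (rconst (1/2) * fps_X ^ 2)
          + fps_X * fps_const (chi_resc / (1 - fps_X))))"
    using qqed_W_1 by (intro fps_X_power2_dvdI) (simp_all add: qqed_W_0 free_W1_def)
  show "fps_X ^ 2 dvd (qqed_G - (fps_const (- rconst (1/2) * fps_X ^ 2)
          + fps_X * fps_const ((fps_X - 1) / chi_resc)))"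
  proof -
    have "(fps_X - 1) / chi_resc = - inverse free_W1"
      unfolding inverse_free_W1 using chi_resc_nth_0
      by (simp add: fps_divide_unit left_diff_distrib)
    then show ?thesis
      using qqed_G_low_order(2) by (intro fps_X_power2_dvdI) (simp_all add: qqed_G_low_order(1))
  qed
  show "has_asymptotics_upto 2 (1/2) qqed_Z (- 3/2)
         (fps_X * fps_const (rconst (1 / sqrt (2 * pi)) * exp_over_hbar fps_X))"
  \<comment> \<open>The factor 1/hbar of \<open>qqed_Z $ 1\<close> changes the exponent from -1/2 to
    -3/2.\<close>
  proof (rule has_asymptotics_upto_2I[where N = 1])
    show "coeff_asymp (qqed_Z $ 0) 0" unfolding qqed_Z_0 by (rule coeff_asymp_gaussian)
    have "coeff_asymp (fps_const fls_X_inv) 0"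
      using laurent_asymp_monomial[of 1 1] by (intro coeff_asymp_0I) (simp add: laurent_asymp_0)
    \<comment> \<open>The factors in front of \<open>free_W1\<close> have zero expansion, so the
      product rule merely multiplies \<open>saddle\<close> by them.\<close>
    from coeff_asymp_mult[OF coeff_asymp_mult[OF this coeff_asymp_gaussian] coeff_asymp_free_W1]
    show "coeff_asymp (qqed_Z $ 1) (fps_const (fls_X_inv ^ 1) * exp_over_hbar fps_X)"
      unfolding qqed_Z_1 gaussian_times_saddle[symmetric] by (simp add: mult.assoc)
  qed simp
  show "has_asymptotics_upto 2 (1/2) qqed_W (- 1/2)
         (fps_X * fps_const (rconst (1 / sqrt (2 * pi))
            * exp_over_hbar (fps_X - rconst (1/2) * fps_X ^ 2)))"
  proof (rule has_asymptotics_upto_2I[where N = 0])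
    show "coeff_asymp (qqed_W $ 0) 0"
      unfolding qqed_W_0 rconst_def by (rule coeff_asymp_const_mult_X_square)
    show "coeff_asymp (qqed_W $ 1) (fps_const (fls_X_inv ^ 0) * exp_over_hbar (fps_X - rconst (1/2) * fps_X ^ 2))"
      using coeff_asymp_free_W1 unfolding qqed_W_1 saddle_def by simp
  qed simp
  have "has_asymptotics_upto 2 (1/2) qqed_G (- 1/2)
         (fps_X * fps_const (rconst (1 / sqrt (2 * pi)) * (saddle * inverse free_W1 ^ 2)))"
  proof (rule has_asymptotics_upto_2I[where N = 0])
    have "- rconst (1/2) = fps_const (fls_const (- 1/2))"
      by (simp add: rconst_def fps_eq_iff fls_eq_iff)
    then show "coeff_asymp (qqed_G $ 0) 0"
      unfolding qqed_G_low_order by (simp only: coeff_asymp_const_mult_X_square)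
    \<comment> \<open>The minus signs of G_1 = -1/V and of the derivation applied to 1/V
      cancel.\<close>
    show "coeff_asymp (qqed_G $ 1) (fps_const (fls_X_inv ^ 0) * (saddle * inverse free_W1 ^ 2))"
      using coeff_asymp_inverse_free_W1 laurent_asymp_minus
      unfolding qqed_G_low_order coeff_asymp_def by fastforce
  qed simp
  moreover have "inverse free_W1 ^ 2 = (1 - fps_X) ^ 2 / chi_resc ^ 2"
    unfolding inverse_free_W1 using chi_resc_nth_0
    by (simp add: fps_divide_unit fps_power_zeroth power_mult_distrib fps_inverse_power)
  ultimately show "has_asymptotics_upto 2 (1/2) qqed_G (- 1/2)
         (fps_X * fps_const (rconst (1 / sqrt (2 * pi))
            * exp_over_hbar (fps_X - rconst (1/2) * fps_X ^ 2)
            * ((1 - fps_X) ^ 2 / chi_resc ^ 2)))"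
    by (simp only: saddle_def mult.assoc)
qed

end
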